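(* Let $m\ge 2$ and let $(\mathcal W\cup\mathcal W',\mathcal Y\cup\mathcal Y')$ be an $m$-triangular labyrinth patterns system, with associated white and yellow triangular labyrinth fractals $L^{w}_\infty$ and $L^{y}_\infty$. Then $L^{w}_\infty$ and $L^{y}_\infty$ are dendrites.
   Context: **Triangles.** Let $H=\{(\alpha_1,\alpha_2,\alpha_3)\in[0,1]^3:\alpha_1+\alpha_2+\alpha_3=1\}$, $\mathbb N=\{0,1,2,\dots\}$, $\mathbf P_1=(0,0)$, $\mathbf P_2=(1,0)$, $\mathbf P_3=(1/2,\sqrt3/2)$. $\Delta(\mathbf A_1,\mathbf A_2,\mathbf A_3)$ denotes the full closed triangle with (ordered) vertices $\mathbf A_1,\mathbf A_2,\mathbf A_3$, and $T_1=\Delta(\mathbf P_1,\mathbf P_2,\mathbf P_3)$. For $\Delta=\Delta(\mathbf A_1,\mathbf A_2,\mathbf A_3)\subset T_1$ let $P_\Delta:T_1\to T_1$, $\sum\alpha_i\mathbf P_i\mapsto\sum\alpha_i\mathbf A_i$ for $(\alpha_1,\alpha_2,\alpha_3)\in H$. For $m\ge2$ and $(k_1,k_2,k_3)\in\mathbb Z^3$, $T_m(k_1,k_2,k_3)$ is the triangle with ordered vertices $\mathbf A_i=\frac1m\big(k_1\mathbf P_1+k_2\mathbf P_2+k_3\mathbf P_3+\mathbf P_i\big)$ and $T'_m(k_1,k_2,k_3)$ is the triangle with ordered vertices $\mathbf A_i=\frac1m\big(k_1\mathbf P_1+k_2\mathbf P_2+k_3\mathbf P_3+\mathbf P_1+\mathbf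 P_2+\mathbf P_3-\mathbf P_i\big)$, $i=1,2,3$. Put $\mathcal T_m=\{T_m(k_1,k_2,k_3):k_i\in\mathbb N,\ k_1+k_2+k_3=m-1\}$ and $\mathcal T'_m=\{T'_m(k_1,k_2,k_3):k_i\in\mathbb N,\ k_1+k_2+k_3=m-2\}$. $T_m(k_1,k_2,k_3)$ and $T'_m(k'_1,k'_2,k'_3)$ are $j$-neighbours if $k_j=k'_j+1$ and $k_i=k'_i$ for $i\ne j$ (they then share a side). **Patterns systems.** An $m$-triangular patterns system is a pair $(\mathcal W\cup\mathcal W',\mathcal Y\cup\mathcal Y')$ with $\mathcal W,\mathcal Y\subset\mathcal T_m$ and $\mathcal W',\mathcal Y'\subset\mathcal T'_m$. Put $\mathcal W_1=\mathcal W$, $\mathcal W'_1=\mathcal W'$, $\mathcal Y_1=\mathcal Y$, $\mathcal Y'_1=\mathcal Y'$, and for $n\ge2$ $\mathcal W_n=\{P_{U}(V):U\in\mathcal W_{n-1},V\in\mathcal W_1\}\cup\{P_{U}(V):U\in\mathcal W'_{n-1},V\in\mathcal Y'_1\}$, $\mathcal W'_n=\{P_{U}(V):U\in\mathcal W_{n-1},V\in\mathcal W'_1\}\cup\{P_{U}(V):U\in\mathcal W'_{n-1},V\in\mathcal Y_1\}$, $\mathcal Y_n=\{P_{U}(V):U\in\mathcal Y_{n-1},V\in\mathcal Y_1\}\cup\{P_{U}(V):U\in\mathcal Y'_{n-1},V\in\mathcal W'_1\}$, $\mathcal Y'_n=\{P_{U}(V):U\in\mathcal Y_{n-1},V\in\mathcal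 Y'_1\}\cup\{P_{U}(V):U\in\mathcal Y'_{n-1},V\in\mathcal W_1\}$. Then $\mathcal W_n,\mathcal Y_n\subset\mathcal T_{m^n}$, $\mathcal W'_n,\mathcal Y'_n\subset\mathcal T'_{m^n}$. $\mathcal G(\mathcal W_n\cup\mathcal W'_n)$ is the undirected graph with vertex set $\mathcal W_n\cup\mathcal W'_n$ in which two vertices are joined by an edge labelled $j$ iff they are $j$-neighbours; $\mathcal G(\mathcal Y_n\cup\mathcal Y'_n)$ is defined analogously. **Labyrinth patterns systems.** The system is an $m$-triangular labyrinth patterns system if: (1) (tree property) $\mathcal G(\mathcal W\cup\mathcal W')$ and $\mathcal G(\mathcal Y\cup\mathcal Y')$ are trees; (2) (exits property) there is exactly one triple $(k_1,k_2,k_3)$ of integers in $\{0,\dots,m-1\}$ with $T_m(0,k_1,m-1-k_1)\in\mathcal W$, $T_m(0,m-1-k_1,k_1)\in\mathcal Y$, $T_m(k_2,0,m-1-k_2)\in\mathcal W$, $T_m(m-1-k_2,0,k_2)\in\mathcal Y$, $T_m(k_3,m-1-k_3,0)\in\mathcal W$, $T_m(m-1-k_3,k_3,0)\in\mathcal Y$; (3) (corners property) the sets $\mathcal C(\mathcal W)$, $\mathcal C(\mathcal Y)$ of elements of $\mathcal W$, resp. $\mathcal Y$, that contain one of $\mathbf P_1,\mathbf P_2,\mathbf P_3$ are disjoint and each has at most one element. **Fractals.** $L^{w}_n$ (resp. $L^{y}_n$) is the union of all triangles in $\mathcal W_n\cup\mathcal W'_n$ (resp. $\mathcal Y_n\cup\mathcal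 Y'_n$). The white and yellow triangular labyrinth fractals are $L^{w}_\infty=\bigcap_{n\ge1}L^{w}_n$ and $L^{y}_\infty=\bigcap_{n\ge1}L^{y}_n$. A dendrite is a locally connected continuum (compact connected metric space) that contains no simple closed curve. *)

theory Defs
  imports "HOL-Analysis.Analysis"
begin

section \<open>Triangles\<close>

text \<open>
  A triangle is given by its ordered vertices; the point set it occupies is \<open>full A\<close>.  The order
  is needed because \<open>tri_map A\<close> depends on it.
\<close>

type_synonym triangle = "(real^2)^3"

abbreviation full :: "triangle \<Rightarrow> (real^2) set" where
  "full A \<equiv> convex hull (range (($) A))"

text \<open>The vertex $P_i$ is \<open>base $ i\<close>, and $T_1$ is \<open>full base\<close>.\<close>

definition base :: triangle where
  "base = vector [vector [0, 0], vector [1, 0], vector [1/2, sqrt 3 / 2]]"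

definition bary_coords :: "(real^3) set" where
  "bary_coords = {\<alpha>. (\<forall>i. \<alpha> $ i \<in> {0..1}) \<and> (\<Sum>i\<in>UNIV. \<alpha> $ i) = 1}"

definition comb :: "real^3 \<Rightarrow> triangle \<Rightarrow> real^2" where
  "comb \<alpha> A = (\<Sum>i\<in>UNIV. (\<alpha> $ i) *\<^sub>R (A $ i))"

text \<open>\<open>tri_map A\<close> is the map $P_A$; it is meaningful on \<open>full base\<close> only, where barycentric
  coordinates in \<open>bary_coords\<close> exist and are unique.\<close>

definition tri_map :: "triangle \<Rightarrow> real^2 \<Rightarrow> real^2" where
  "tri_map A x = comb (THE \<alpha>. \<alpha> \<in> bary_coords \<and> x = comb \<alpha> base) A"

text \<open>The triangle $P_U(V)$, with ordered vertices; see \<open>full_subtriangle\<close> below.\<close>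

definition subtriangle :: "triangle \<Rightarrow> triangle \<Rightarrow> triangle" where
  "subtriangle U V = (\<chi> i. tri_map U (V $ i))"

text \<open>$T_m(k)$ and $T'_m(k)$.\<close>

definition up_tri :: "nat \<Rightarrow> int^3 \<Rightarrow> triangle" where
  "up_tri m k = (\<chi> i. (1 / real m) *\<^sub>R ((\<Sum>j\<in>UNIV. real_of_int (k $ j) *\<^sub>R base $ j) + base $ i))"

definition down_tri :: "nat \<Rightarrow> int^3 \<Rightarrow> triangle" where
  "down_tri m k = (\<chi> i. (1 / real m) *\<^sub>R
     ((\<Sum>j\<in>UNIV. real_of_int (k $ j) *\<^sub>R base $ j) + (\<Sum>j\<in>UNIV. base $ j) - base $ i))"

definition indices :: "int \<Rightarrow> (int^3) set" where
  "indices s = {k. (\<forall>i. 0 \<le> k $ i) \<and> (\<Sum>i\<in>UNIV. k $ i) = s}"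

definition upright :: "nat \<Rightarrow> triangle set" where
  "upright m = up_tri m ` indices (int m - 1)"

definition inverted :: "nat \<Rightarrow> triangle set" where
  "inverted m = down_tri m ` indices (int m - 2)"

text \<open>
  Since \<open>base $ 1 = 0\<close>, the triangle \<open>up_tri m k\<close> does not determine \<open>k $ 1\<close>; only the prescribed
  coordinate sum does.  So the index sets may not be dropped here.
\<close>

definition neighbours :: "nat \<Rightarrow> 3 \<Rightarrow> triangle \<Rightarrow> triangle \<Rightarrow> bool" where
  "neighbours m j U V \<longleftrightarrow> (\<exists>k \<in> indices (int m - 1). \<exists>k' \<in> indices (int m - 2).
     U = up_tri m k \<and> V = down_tri m k' \<and> k $ j = k' $ j + 1 \<and> (\<forall>i. i \<noteq> j \<longrightarrow> k $ i = k' $ i))"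

definition adjacent :: "nat \<Rightarrow> triangle \<Rightarrow> triangle \<Rightarrow> bool" where
  "adjacent m U V \<longleftrightarrow> (\<exists>j. neighbours m j U V \<or> neighbours m j V U)"


section \<open>Trees\<close>

text \<open>Undirected simple graphs, given by a vertex set and a symmetric irreflexive relation.
  In particular \<open>[u, v]\<close> is not a cycle.\<close>

definition connected_graph :: "'a set \<Rightarrow> ('a \<Rightarrow> 'a \<Rightarrow> bool) \<Rightarrow> bool" where
  "connected_graph V E \<longleftrightarrow> V \<noteq> {} \<and>
     (\<forall>u\<in>V. \<forall>v\<in>V. \<exists>p. p \<noteq> [] \<and> hd p = u \<and> last p = v \<and> set p \<subseteq> V \<and> successively E p)"

definition graph_cycle :: "'a set \<Rightarrow> ('a \<Rightarrow> 'a \<Rightarrow> bool) \<Rightarrow> 'a list \<Rightarrow> bool" where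
  "graph_cycle V E p \<longleftrightarrow> 3 \<le> length p \<and> distinct p \<and> set p \<subseteq> V \<and>
     successively E p \<and> E (last p) (hd p)"

definition tree :: "'a set \<Rightarrow> ('a \<Rightarrow> 'a \<Rightarrow> bool) \<Rightarrow> bool" where
  "tree V E \<longleftrightarrow> connected_graph V E \<and> (\<nexists>p. graph_cycle V E p)"


section \<open>Patterns systems\<close>

record patterns =
  white :: "triangle set"
  white' :: "triangle set"
  yellow :: "triangle set"
  yellow' :: "triangle set"

definition patterns_system :: "nat \<Rightarrow> patterns \<Rightarrow> bool" where
  "patterns_system m S \<longleftrightarrow> white S \<subseteq> upright m \<and> yellow S \<subseteq> upright m \<and>
     white' S \<subseteq> inverted m \<and> yellow' S \<subseteq> inverted m"

definition substitute :: "triangle set \<Rightarrow> triangle set \<Rightarrow> triangle set" where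
  "substitute A B = {subtriangle U V | U V. U \<in> A \<and> V \<in> B}"

definition refine :: "patterns \<Rightarrow> patterns \<Rightarrow> patterns" where
  "refine R S = \<lparr>
     white = substitute (white R) (white S) \<union> substitute (white' R) (yellow' S),
     white' = substitute (white R) (white' S) \<union> substitute (white' R) (yellow S),
     yellow = substitute (yellow R) (yellow S) \<union> substitute (yellow' R) (white' S),
     yellow' = substitute (yellow R) (yellow' S) \<union> substitute (yellow' R) (white S)\<rparr>"

text \<open>\<open>level S n\<close> comprises $W_n, W'_n, Y_n, Y'_n$ for $n \ge 1$; the value at \<open>0\<close> is never used.\<close>

fun level :: "patterns \<Rightarrow> nat \<Rightarrow> patterns" where
  "level S 0 = undefined"
| "level S (Suc 0) = S"
| "level S (Suc (Suc n)) = refine (level S (Suc n)) S"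

definition corner_triangles :: "triangle set \<Rightarrow> triangle set" where
  "corner_triangles A = {U \<in> A. \<exists>i. base $ i \<in> full U}"

definition tree_property :: "nat \<Rightarrow> patterns \<Rightarrow> bool" where
  "tree_property m S \<longleftrightarrow>
     tree (white S \<union> white' S) (adjacent m) \<and> tree (yellow S \<union> yellow' S) (adjacent m)"

definition exits_property :: "nat \<Rightarrow> patterns \<Rightarrow> bool" where
  "exits_property m S \<longleftrightarrow> (\<exists>!k::int^3. (\<forall>i. k $ i \<in> {0..int m - 1}) \<and>
     up_tri m (vector [0, k $ 1, int m - 1 - k $ 1]) \<in> white S \<and>
     up_tri m (vector [0, int m - 1 - k $ 1, k $ 1]) \<in> yellow S \<and>
     up_tri m (vector [k $ 2, 0, int m - 1 - k $ 2]) \<in> white S \<and>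
     up_tri m (vector [int m - 1 - k $ 2, 0, k $ 2]) \<in> yellow S \<and>
     up_tri m (vector [k $ 3, int m - 1 - k $ 3, 0]) \<in> white S \<and>
     up_tri m (vector [int m - 1 - k $ 3, k $ 3, 0]) \<in> yellow S)"

definition corners_property :: "patterns \<Rightarrow> bool" where
  "corners_property S \<longleftrightarrow>
     corner_triangles (white S) \<inter> corner_triangles (yellow S) = {} \<and>
     (\<forall>U \<in> corner_triangles (white S). \<forall>V \<in> corner_triangles (white S). U = V) \<and>
     (\<forall>U \<in> corner_triangles (yellow S). \<forall>V \<in> corner_triangles (yellow S). U = V)"

definition labyrinth_patterns_system :: "nat \<Rightarrow> patterns \<Rightarrow> bool" where
  "labyrinth_patterns_system m S \<longleftrightarrow>
     patterns_system m S \<and> tree_property m S \<and> exits_property m S \<and> corners_property S"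

definition white_fractal :: "patterns \<Rightarrow> (real^2) set" where
  "white_fractal S =
     (\<Inter>n\<in>{1..}. \<Union>U \<in> white (level S n) \<union> white' (level S n). full U)"

definition yellow_fractal :: "patterns \<Rightarrow> (real^2) set" where
  "yellow_fractal S =
     (\<Inter>n\<in>{1..}. \<Union>U \<in> yellow (level S n) \<union> yellow' (level S n). full U)"


section \<open>Dendrites\<close>

text \<open>Continua are nonempty by convention.\<close>

definition dendrite :: "'a::metric_space set \<Rightarrow> bool" where
  "dendrite X \<longleftrightarrow> X \<noteq> {} \<and> compact X \<and> connected X \<and> locally connected X \<and>
     (\<nexists>g. simple_path g \<and> pathfinish g = pathstart g \<and> path_image g \<subseteq> X)"


section \<open>The image of a triangle under a triangle map\<close>

lemma full_eq_comb: "full A = (\<lambda>\<alpha>. comb \<alpha> A) ` bary_coords"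
proof -
  have "range (($) A) = {A $ 1, A $ 2, A $ 3}"
    by (auto simp: image_def) (metis exhaust_3)+
  then have eq: "full A = {u *\<^sub>R A $ 1 + v *\<^sub>R A $ 2 + w *\<^sub>R A $ 3 | u v w.
      0 \<le> u \<and> 0 \<le> v \<and> 0 \<le> w \<and> u + v + w = 1}"
    by (simp add: convex_hull_3)
  show ?thesis
  proof (intro equalityI subsetI)
    fix x assume "x \<in> full A"
    then obtain u v w :: real where uvw: "x = u *\<^sub>R A $ 1 + v *\<^sub>R A $ 2 + w *\<^sub>R A $ 3"
      "0 \<le> u" "0 \<le> v" "0 \<le> w" "u + v + w = 1" unfolding eq by blast
    have "vector [u, v, w] \<in> bary_coords" using uvw by (auto simp: bary_coords_def forall_3 sum_3)
    moreover have "x = comb (vector [u, v, w]) A" using uvw by (simp add: comb_def sum_3)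
    ultimately show "x \<in> (\<lambda>\<alpha>. comb \<alpha> A) ` bary_coords" by blast
  next
    fix x assume "x \<in> (\<lambda>\<alpha>. comb \<alpha> A) ` bary_coords"
    then obtain \<alpha> where a: "\<alpha> \<in> bary_coords" "x = comb \<alpha> A" by blast
    then show "x \<in> full A" unfolding eq
      by (simp add: bary_coords_def forall_3 sum_3 comb_def) blast
  qed
qed

lemma comb_base_inj:
  assumes "\<alpha> \<in> bary_coords" "\<beta> \<in> bary_coords" "comb \<alpha> base = comb \<beta> base"
  shows "\<alpha> = \<beta>"
  using assms by (auto simp: bary_coords_def comb_def sum_3 base_def vec_eq_iff forall_2 forall_3)

lemma tri_map_comb: "\<alpha> \<in> bary_coords \<Longrightarrow> tri_map A (comb \<alpha> base) = comb \<alpha> A"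
  unfolding tri_map_def by (rule arg_cong[where f = "\<lambda>a. comb a A"]) (auto dest: comb_base_inj)

lemma full_subtriangle:
  assumes "full V \<subseteq> full base"
  shows "full (subtriangle U V) = tri_map U ` full V"
proof -
  have "\<exists>\<gamma>. \<gamma> \<in> bary_coords \<and> V $ i = comb \<gamma> base" for i
    using assms hull_inc[of "V $ i" "range (($) V)" convex] full_eq_comb[of base] by blast
  then obtain \<gamma> where g: "\<And>i. \<gamma> i \<in> bary_coords" "\<And>i. V $ i = comb (\<gamma> i) base" by metis
  have "tri_map U (comb \<beta> V) = comb \<beta> (subtriangle U V)" if b: "\<beta> \<in> bary_coords" for \<beta>
  proof -
    define d where "d = (\<Sum>i\<in>UNIV. \<beta> $ i *\<^sub>R \<gamma> i)"
    have "convex bary_coords"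
      unfolding bary_coords_def convex_def
      by (auto simp: sum.distrib sum_distrib_left[symmetric] intro: convex_bound_le)
    then have dH: "d \<in> bary_coords" unfolding d_def using b g
      by (intro convex_sum) (auto simp: bary_coords_def)
    have d: "comb d A = (\<Sum>i\<in>UNIV. \<beta> $ i *\<^sub>R comb (\<gamma> i) A)" for A
      by (simp add: d_def comb_def sum_3 algebra_simps)
    have "comb \<beta> V = comb d base" by (simp add: d comb_def[of \<beta>] g(2))
    then have "tri_map U (comb \<beta> V) = comb d U" using tri_map_comb[OF dH] by simp
    also have "\<dots> = comb \<beta> (subtriangle U V)"
      by (simp add: d comb_def[of \<beta>] subtriangle_def g tri_map_comb)
    finally show ?thesis .
  qed
  then show ?thesis by (simp add: full_eq_comb image_image)
qed

end

theory Submission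
  imports Defs
begin

text \<open>
  Write \<open>L c\<close> for the fractal of colour \<open>c\<close>.  Substitution is associative, so \<open>L c\<close> is the union of
  its pieces, the images of \<open>L c\<close> in the upright and of \<open>L (\<not> c)\<close> in the inverted triangles of
  the pattern.  By the corners property at most one vertex of $T_1$ lies in each fractal, and the two
  vertices differ; hence pieces can only meet if their triangles share a side.  On such a side a
  common point corresponds to a pair of mirror points of the two fractals.  The exits property
  forces such a pair into the exit cells, where blowing up gives a pair of the same kind, so it is
  unique, and the fixed points of the exit cells form one.

  Thus neighbouring pieces meet in exactly one point and all others are disjoint.  Connectedness of
  the pattern graph yields connected approximations, hence a connected fractal, and by
  self-similarity coverings by finitely many small continua, hence local connectedness.  A closed
  curve cannot cross a cut point, so as the pattern graph is a tree, it lies in a single piece.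
  Blowing up that piece repeatedly would give arbitrarily large closed curves.
\<close>

section \<open>Barycentric coordinates\<close>

text \<open>An explicit inverse of \<open>comb _ base\<close>, affine on the whole plane. It makes
  the \<open>THE\<close> in \<open>tri_map\<close> computable and turns statements about positions
  of triangles into arithmetic in each coordinate.\<close>

definition bary :: "real^2 \<Rightarrow> real^3" where
  "bary x = vector [1 - x $ 1 - x $ 2 / sqrt 3, x $ 1 - x $ 2 / sqrt 3, 2 * x $ 2 / sqrt 3]"

lemma sum_bary: "bary x $ 1 + bary x $ 2 + bary x $ 3 = 1"
  by (simp add: bary_def)

lemma bary_comb: "(\<Sum>i\<in>UNIV. \<alpha> $ i) = 1 \<Longrightarrow> bary (comb \<alpha> base) = \<alpha>"
  by (auto simp: vec_eq_iff forall_3 sum_3 bary_def comb_def base_def field_simps)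

lemma comb_bary: "comb (bary x) base = x"
  by (auto simp: vec_eq_iff forall_2 sum_3 bary_def comb_def base_def field_simps)

lemma bary_inject: "bary x = bary y \<longleftrightarrow> x = y"
  by (metis comb_bary)

lemma bary_base: "bary (base $ i) = axis i 1"
proof -
  have "comb (axis i 1) base = base $ i"
    using exhaust_3[of i] by (auto simp: comb_def sum_3 axis_def)
  moreover have "(\<Sum>j\<in>UNIV. axis i (1::real) $ j) = 1"
    using exhaust_3[of i] by (auto simp: sum_3 axis_def)
  ultimately show ?thesis by (metis bary_comb)
qed

lemma mem_base_iff: "x \<in> full base \<longleftrightarrow> (\<forall>i. 0 \<le> bary x $ i)"
proof
  assume "x \<in> full base"
  then obtain \<alpha> where "\<alpha> \<in> bary_coords" "x = comb \<alpha> base" by (auto simp: full_eq_comb)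
  then show "\<forall>i. 0 \<le> bary x $ i" by (auto simp: bary_coords_def bary_comb)
next
  assume nonneg: "\<forall>i. 0 \<le> bary x $ i"
  then have "bary x \<in> bary_coords"
    using sum_bary[of x] by (auto simp: bary_coords_def forall_3 sum_3)
  then show "x \<in> full base" by (metis comb_bary full_eq_comb imageI)
qed

lemma bary_in_coords: "x \<in> full base \<Longrightarrow> bary x \<in> bary_coords"
  using sum_bary[of x] by (auto simp: mem_base_iff bary_coords_def forall_3 sum_3)

lemma bary_nonneg: "x \<in> full base \<Longrightarrow> 0 \<le> bary x $ i"
  by (simp add: mem_base_iff)

lemma bary_le_1: "x \<in> full base \<Longrightarrow> bary x $ i \<le> 1"
  using bary_in_coords by (auto simp: bary_coords_def)

lemma eq_base_if_bary_1:
  assumes "x \<in> full base" "bary x $ i = 1"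
  shows "x = base $ i"
proof -
  have "bary x = axis i 1"
    using assms exhaust_3[of i] sum_bary[of x] bary_nonneg[OF assms(1)]
    by (auto simp: vec_eq_iff forall_3 axis_def)
       (smt (verit) bary_nonneg[OF assms(1)])+
  then show ?thesis by (metis bary_base bary_inject)
qed

lemma tri_map_bary: "x \<in> full base \<Longrightarrow> tri_map A x = comb (bary x) A"
  by (metis bary_in_coords comb_bary tri_map_comb)

lemma full_eq_image: "full A = tri_map A ` full base"
  by (auto simp: full_eq_comb image_image tri_map_comb)

text \<open>An affine map respects combinations of total weight 1. Eliminating the first weight
  builds that constraint into the terms, so only linear identities remain.\<close>

lemma bary_affine:
  assumes "(\<Sum>i\<in>UNIV. \<alpha> $ i) = 1"
  shows "bary (comb \<alpha> A) = (\<Sum>i\<in>UNIV. \<alpha> $ i *\<^sub>R bary (A $ i))"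
proof -
  have \<alpha>: "\<alpha> $ 1 = 1 - \<alpha> $ 2 - \<alpha> $ 3" using assms by (simp add: sum_3)
  show ?thesis
    by (simp add: vec_eq_iff forall_3 sum_3 bary_def comb_def \<alpha> algebra_simps
        add_divide_distrib diff_divide_distrib)
qed

text \<open>Both sides are affine in \<open>x\<close> and agree at the vertices, where
  \<open>subtriangle\<close> stores exactly the images under \<open>tri_map U\<close>. This is what
  makes substitution associative.\<close>

lemma tri_map_subtriangle:
  assumes "full V \<subseteq> full base" "x \<in> full base"
  shows "tri_map (subtriangle U V) x = tri_map U (tri_map V x)"
proof -
  have \<alpha>: "(\<Sum>i\<in>UNIV. bary x $ i) = 1" using sum_bary[of x] by (simp add: sum_3)
  have V: "V $ i \<in> full base" for i
    using assms(1) hull_inc[of "V $ i" "range (($) V)" convex] by blast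
  have "tri_map V x \<in> full base" using assms full_eq_image by blast
  then have "tri_map U (tri_map V x) = comb (bary (comb (bary x) V)) U"
    using assms by (simp add: tri_map_bary)
  also have "\<dots> = comb (bary x) (subtriangle U V)"
    unfolding bary_affine[OF \<alpha>]
    by (simp add: comb_def sum_3 subtriangle_def tri_map_bary[OF V] algebra_simps)
  finally show ?thesis using assms by (simp add: tri_map_bary)
qed

lemma continuous_on_tri_map: "continuous_on (full base) (tri_map A)"
proof -
  have "continuous_on (full base) (\<lambda>x. comb (bary x) A)"
    unfolding comb_def sum_3 bary_def vector_3
    by (intro continuous_intros)  auto
  then show ?thesis by (simp add: tri_map_bary cong: continuous_on_cong)
qed

section \<open>The cell maps in coordinates\<close>

lemma tri_map_up:
  "x \<in> full base \<Longrightarrow> tri_map (up_tri m k) x = (1 / real m) *\<^sub>R ((\<Sum>j\<in>UNIV. real_of_int (k $ j) *\<^sub>R base $ j) + x)"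
proof -
  assume x: "x \<in> full base"
  define v where "v = (\<Sum>j\<in>UNIV. real_of_int (k $ j) *\<^sub>R base $ j)"
  have 1: "bary x $ 1 = 1 - bary x $ 2 - bary x $ 3" using sum_bary[of x] by simp
  have "tri_map (up_tri m k) x = (1 / real m) *\<^sub>R (v + comb (bary x) base)"
    unfolding tri_map_bary[OF x]
    by (simp add: up_tri_def comb_def flip: v_def) (simp add: sum_3 1 algebra_simps add_divide_distrib diff_divide_distrib)
  then show ?thesis by (simp add: comb_bary v_def)
qed

lemma tri_map_down:
  "x \<in> full base \<Longrightarrow> tri_map (down_tri m k) x =
    (1 / real m) *\<^sub>R ((\<Sum>j\<in>UNIV. real_of_int (k $ j) *\<^sub>R base $ j) + (\<Sum>j\<in>UNIV. base $ j) - x)"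
proof -
  assume x: "x \<in> full base"
  define v where "v = (\<Sum>j\<in>UNIV. real_of_int (k $ j) *\<^sub>R base $ j) + (\<Sum>j\<in>UNIV. base $ j)"
  have 1: "bary x $ 1 = 1 - bary x $ 2 - bary x $ 3" using sum_bary[of x] by simp
  have "tri_map (down_tri m k) x = (1 / real m) *\<^sub>R (v - comb (bary x) base)"
    unfolding tri_map_bary[OF x]
    by (simp add: down_tri_def comb_def flip: v_def) (simp add: sum_3 1 algebra_simps add_divide_distrib diff_divide_distrib)
  then show ?thesis by (simp add: comb_bary v_def)
qed

text \<open>In barycentric coordinates an upright cell prepends \<open>k\<close> as a
  base-\<open>m\<close> digit. The prescribed digit sum keeps the total weight equal to 1. The later
  incidence arguments are digit comparisons based on this formula and on its inverted counterpart,
  where the sign is reversed.\<close>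

lemma bary_tri_map_up:
  assumes "x \<in> full base" "k \<in> indices (int m - 1)" "m > 0"
  shows "bary (tri_map (up_tri m k) x) $ i = (k $ i + bary x $ i) / m"
proof -
  define \<beta> :: "real^3" where "\<beta> = (\<chi> i. (k $ i + bary x $ i) / m)"
  have "k $ 1 + k $ 2 + k $ 3 = int m - 1" using assms(2) by (simp add: indices_def sum_3)
  then have "real_of_int (k $ 1 + k $ 2 + k $ 3) = real m - 1" by simp
  then have "(\<Sum>i\<in>UNIV. \<beta> $ i) = 1"
    using sum_bary[of x] assms(3) by (simp add: \<beta>_def sum_3 flip: add_divide_distrib)
  moreover have "tri_map (up_tri m k) x = comb \<beta> base"
    unfolding tri_map_up[OF assms(1)]
    by (subst comb_bary[of x, symmetric]) (simp add: comb_def sum_3 \<beta>_def algebra_simps add_divide_distrib)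
  ultimately show ?thesis by (simp add: bary_comb \<beta>_def)
qed

lemma bary_tri_map_down:
  assumes "x \<in> full base" "k \<in> indices (int m - 2)" "m > 0"
  shows "bary (tri_map (down_tri m k) x) $ i = (k $ i + 1 - bary x $ i) / m"
proof -
  define \<beta> :: "real^3" where "\<beta> = (\<chi> i. (k $ i + 1 - bary x $ i) / m)"
  have "k $ 1 + k $ 2 + k $ 3 = int m - 2" using assms(2) by (simp add: indices_def sum_3)
  then have "real_of_int (k $ 1 + k $ 2 + k $ 3) = real m - 2" by simp
  then have "(\<Sum>i\<in>UNIV. \<beta> $ i) = 1"
    using sum_bary[of x] assms(3) by (simp add: \<beta>_def sum_3 flip: add_divide_distrib)
  moreover have "tri_map (down_tri m k) x = comb \<beta> base"
    unfolding tri_map_down[OF assms(1)]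
    by (subst comb_bary[of x, symmetric])
      (simp add: comb_def sum_3 \<beta>_def algebra_simps add_divide_distrib diff_divide_distrib)
  ultimately show ?thesis by (simp add: bary_comb \<beta>_def)
qed

lemma full_subset_base:
  assumes "A \<in> upright m \<union> inverted m" "m > 0"
  shows "full A \<subseteq> full base"
proof -
  have "tri_map A x \<in> full base" if x: "x \<in> full base" for x
    using assms(1)
  proof
    assume "A \<in> upright m"
    then obtain k where k: "k \<in> indices (int m - 1)" "A = up_tri m k" by (auto simp: upright_def)
    have "0 \<le> k $ i" for i using k by (simp add: indices_def)
    then show ?thesis using bary_nonneg[OF x] assms(2)
      by (simp add: mem_base_iff bary_tri_map_up[OF x] k)
  next
    assume "A \<in> inverted m"
    then obtain k where k: "k \<in> indices (int m - 2)" "A = down_tri m k" by (auto simp: inverted_def)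
    have "0 \<le> real_of_int (k $ i) + (1 - bary x $ i)" for i
      using k bary_le_1[OF x, of i] by (intro add_nonneg_nonneg) (auto simp: indices_def)
    then show ?thesis using assms(2)
      by (simp add: mem_base_iff bary_tri_map_down[OF x] k add_diff_eq)
  qed
  then show ?thesis unfolding full_eq_image[of A] by blast
qed

lemma dist_tri_map:
  assumes "A \<in> upright m \<union> inverted m" "x \<in> full base" "y \<in> full base"
  shows "dist (tri_map A x) (tri_map A y) = dist x y / m"
proof -
  consider k where "A = up_tri m k" | k where "A = down_tri m k"
    using assms(1) by (auto simp: upright_def inverted_def)
  then have "tri_map A x - tri_map A y = (1 / real m) *\<^sub>R (x - y) \<or>
      tri_map A x - tri_map A y = (1 / real m) *\<^sub>R (y - x)"
    using assms(2,3) by cases (simp_all add: tri_map_up tri_map_down flip: scaleR_diff_right)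
  then show ?thesis by (auto simp: dist_norm norm_minus_commute)
qed

text \<open>The horizontal displacement from the first vertex to the second is \<open>1 / m\<close>
  in an upright and \<open>- 1 / m\<close> in an inverted triangle. Hence membership in
  \<open>upright m\<close> can serve as a test of orientation.\<close>

lemma upright_inverted_disjoint:
  assumes "m > 0"
  shows "upright m \<inter> inverted m = {}"
proof -
  have "up_tri m k $ 2 $ 1 - up_tri m k $ 1 $ 1 = 1 / m"
    "down_tri m k' $ 2 $ 1 - down_tri m k' $ 1 $ 1 = - 1 / m" for k k'
    by (simp_all add: up_tri_def down_tri_def base_def field_simps)
  then have "up_tri m k \<noteq> down_tri m k'" for k k'
    using assms by (metis less_irrefl of_nat_eq_0_iff one_neq_neg_one divide_cancel_right)
  then show ?thesis by (auto simp: upright_def inverted_def)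
qed

lemma index_3_third:
  assumes "j \<noteq> (i :: 3)"
  obtains l where "UNIV = {i, j, l}" "i \<noteq> j" "i \<noteq> l" "j \<noteq> l"
proof -
  have "card (UNIV - {i, j}) = 1" using assms by (subst card_Diff_subset) auto
  then obtain l where l: "UNIV - {i, j} = {l}" by (rule card_1_singletonE)
  then have "l \<noteq> i" "l \<noteq> j" "UNIV = {i, j, l}" by blast+
  then show thesis using that assms by metis
qed

lemma index_3_others: obtains j l :: 3 where "UNIV = {i, j, l}" "i \<noteq> j" "i \<noteq> l" "j \<noteq> l"
proof -
  have "(if i = 1 then 2 else 1) \<noteq> i" by auto
  then show thesis using index_3_third that by blast
qed

lemma sum_bary_others:
  assumes "UNIV = {i, j, l :: 3}" "i \<noteq> j" "i \<noteq> l" "j \<noteq> l"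
  shows "bary x $ i + bary x $ j + bary x $ l = 1"
proof -
  have "(\<Sum>i\<in>UNIV. bary x $ i) = 1" using sum_bary[of x] by (simp add: sum_3)
  then show ?thesis unfolding assms(1) using assms(2-4) by simp
qed

lemma exists_3: "(\<exists>i::3. P i) \<longleftrightarrow> P 1 \<or> P 2 \<or> P 3"
  by (metis exhaust_3)

section \<open>Forests of sets\<close>

text \<open>The end of a longest path in a forest is a leaf.\<close>

lemma acyclic_graph_leaf:
  assumes "finite V" "V \<noteq> {}" and sym: "\<And>u v. E u v \<Longrightarrow> E v u"
    and acyclic: "\<nexists>p. graph_cycle V E p"
  obtains v w where "v \<in> V" "\<And>u. u \<in> V \<Longrightarrow> E v u \<Longrightarrow> u = v \<or> u = w"
proof -
  define P where "P p \<longleftrightarrow> p \<noteq> [] \<and> distinct p \<and> set p \<subseteq> V \<and> successively E p" for p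
  obtain x where "x \<in> V" using assms by blast
  then have "P [x]" by (simp add: P_def)
  moreover have "length p \<le> card V" if "P p" for p
    using that card_mono[OF \<open>finite V\<close>, of "set p"] by (simp add: P_def distinct_card)
  ultimately obtain p where p: "P p" and max: "\<And>q. P q \<Longrightarrow> length q \<le> length p"
    using ex_has_greatest_nat[of P "[x]" length "Suc (card V)"] by (metis le_imp_less_Suc)
  then obtain v r where vr: "p = v # r" by (auto simp: P_def neq_Nil_conv)
  have "u = v \<or> u = hd r" if u: "u \<in> V" "E v u" for u
  proof -
    have "u \<in> set p"
    proof (rule ccontr)
      assume "u \<notin> set p"
      then have "P (u # p)" using p u sym vr by (auto simp: P_def successively_Cons)
      then show False using max by fastforce
    qed
    then obtain i where i: "i < length p" "u = p ! i" by (metis in_set_conv_nth)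
    have "\<not> i \<ge> 2"
    proof
      assume "i \<ge> 2"
      \<comment> \<open>The prefix of the path that runs from \<open>v\<close> to \<open>u\<close>
        is closed up by the edge from \<open>u\<close> back to \<open>v\<close>. Because
        \<open>i\<close> is at least 2, it has the three vertices that a cycle requires.\<close>
      let ?q = "take (Suc i) p"
      have "successively E ?q" using p i
        by (metis P_def append_take_drop_id successively_append_iff)
      moreover have "last ?q = u" using i by (simp add: take_Suc_conv_app_nth)
      moreover have "hd ?q = v" by (simp add: vr)
      ultimately have "graph_cycle V E ?q"
        using p i \<open>2 \<le> i\<close> u sym set_take_subset[of "Suc i" p] by (auto simp: graph_cycle_def P_def)
      then show False using acyclic by blast
    qed
    then consider "i = 0" | "i = 1" by linarith
    then show ?thesis
      using i vr by cases (auto simp: hd_conv_nth)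
  qed
  then show ?thesis using that p vr by (auto simp: P_def)
qed

text \<open>Reparametrise the closed curve to start and end at \<open>p\<close>. What is left after
  removing \<open>p\<close> is then a simple path without its endpoints.\<close>

lemma closed_curve_minus_point_connected:
  assumes "simple_path g" "pathfinish g = pathstart g" "p \<in> path_image g"
  shows "connected (path_image g - {p})"
proof -
  obtain a where a: "a \<in> {0..1}" "p = g a" using assms by (auto simp: path_image_def)
  let ?h = "shiftpath a g"
  have "simple_path ?h" using simple_path_shiftpath assms a by auto
  moreover have "pathstart ?h = p" using a by (simp add: pathstart_shiftpath)
  moreover have "pathfinish ?h = p" using a assms
    by (simp add: pathfinish_shiftpath)
  ultimately have "connected (path_image ?h - {p})"
    using connected_simple_path_endless by fastforce
  then show ?thesis using path_image_shiftpath a assms by metis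
qed

text \<open>A simple path may only identify the parameters 0 and 1, so its values at 0 and 1/2
  differ.\<close>

lemma simple_path_not_singleton:
  assumes "simple_path g" shows "\<not> path_image g \<subseteq> {p}"
proof
  assume "path_image g \<subseteq> {p}"
  then have "g 0 = p" "g (1/2) = p" by (auto simp: path_image_def image_subset_iff)
  then show False using assms
    by (force simp: simple_path_def loop_free_def dest: bspec[of _ _ 0] bspec[of _ _ "1/2"])
qed

text \<open>Without \<open>p\<close> the curve is still connected, while \<open>A\<close> and
  \<open>B\<close> have become disjoint on it; so one of them contains all of the curve except
  possibly \<open>p\<close>.\<close>

lemma closed_curve_in_union_meeting_in_point:
  fixes g :: "real \<Rightarrow> 'a::t1_space"
  assumes g: "simple_path g" "pathfinish g = pathstart g"
    and AB: "closed A" "closed B" "A \<inter> B \<subseteq> {p}" "path_image g \<subseteq> A \<union> B"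
  shows "path_image g \<subseteq> A \<or> path_image g \<subseteq> B"
proof -
  let ?J = "path_image g"
  have J: "connected (?J - {p})"
  proof (cases "p \<in> ?J")
    case False
    then show ?thesis using connected_path_image[OF simple_path_imp_path[OF g(1)]] by simp
  qed (rule closed_curve_minus_point_connected[OF g])
  \<comment> \<open>Adding \<open>p\<close> back is harmless: if a closed \<open>C\<close> contained
    everything but \<open>p\<close>, then \<open>p\<close> would be isolated in a connected set with
    more than one point.\<close>
  have whole: "?J \<subseteq> C" if C: "closed C" "?J - {p} \<subseteq> C" for C
  proof (rule ccontr)
    assume "\<not> ?J \<subseteq> C"
    then have p: "p \<in> ?J" "p \<notin> C" using C by auto
    have "connected ?J" using connected_path_image g simple_path_imp_path by blast
    then have "C \<inter> ?J = {} \<or> {p} \<inter> ?J = {}"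
      using C(2) p by (intro connected_closedD C) auto
    then show False using C p simple_path_not_singleton[OF g(1), of p] by blast
  qed
  have "A \<inter> (?J - {p}) = {} \<or> B \<inter> (?J - {p}) = {}"
    using AB by (intro connected_closedD J) auto
  then have "?J - {p} \<subseteq> B \<or> ?J - {p} \<subseteq> A" using AB(4) by blast
  then show ?thesis using whole AB(1,2) by metis
qed

text \<open>Induction on the number of vertices. The set of a leaf \<open>v\<close> can meet only
  the set of its one possible neighbour \<open>w\<close>, hence meets the union of all other sets in
  at most one point. The curve therefore lies in \<open>F v\<close> or avoids the need for
  \<open>v\<close> altogether.\<close>

lemma closed_curve_in_forest_of_sets:
  fixes F :: "'b \<Rightarrow> 'a::t1_space set"
  assumes "finite V" and sym: "\<And>u v. E u v \<Longrightarrow> E v u"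
    and "\<nexists>p. graph_cycle V E p"
    and "\<And>u. u \<in> V \<Longrightarrow> closed (F u)"
    and "\<And>u v. u \<in> V \<Longrightarrow> v \<in> V \<Longrightarrow> u \<noteq> v \<Longrightarrow> F u \<inter> F v \<noteq> {} \<Longrightarrow> E u v"
    and "\<And>u v. u \<in> V \<Longrightarrow> v \<in> V \<Longrightarrow> u \<noteq> v \<Longrightarrow> \<exists>p. F u \<inter> F v \<subseteq> {p}"
    and g: "simple_path g" "pathfinish g = pathstart g" and "path_image g \<subseteq> (\<Union>u\<in>V. F u)"
  shows "\<exists>u\<in>V. path_image g \<subseteq> F u"
  using assms(1,3-6,9)
proof (induction "card V" arbitrary: V)
  case 0
  then show ?case using simple_path_not_singleton[OF g(1)] by auto
next
  case (Suc n)
  then have "V \<noteq> {}" by auto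
  then obtain v w where v: "v \<in> V" and leaf: "\<And>u. u \<in> V \<Longrightarrow> E v u \<Longrightarrow> u = v \<or> u = w"
    using acyclic_graph_leaf[OF Suc.prems(1) _ sym Suc.prems(2)] by metis
  let ?V = "V - {v}" and ?G = "\<Union>u\<in>V - {v}. F u"
  have "\<exists>p. F v \<inter> ?G \<subseteq> {p}"
  proof (cases "w \<in> ?V")
    case True
    then obtain p where p: "F v \<inter> F w \<subseteq> {p}" using Suc.prems(5)[of v w] v by auto
    have "F v \<inter> F u \<subseteq> {p}" if u: "u \<in> ?V" for u
    proof (cases "u = w")
      case False
      then have "\<not> E v u" using leaf[of u] u by blast
      then show ?thesis using Suc.prems(4)[of v u] u v by (metis DiffE empty_subsetI singletonI)
    qed (use p in simp)
    then show ?thesis by blast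
  next
    case False
    have "F v \<inter> F u = {}" if u: "u \<in> ?V" for u
    proof -
      have "\<not> E v u" using leaf[of u] False u by blast
      then show ?thesis using Suc.prems(4)[of v u] u v by (metis DiffE singletonI)
    qed
    then show ?thesis by blast
  qed
  then obtain p where "F v \<inter> ?G \<subseteq> {p}" by blast
  moreover have "closed ?G" "closed (F v)" using Suc.prems v by auto
  moreover have "path_image g \<subseteq> F v \<union> ?G" using Suc.prems(6) by blast
  ultimately consider "path_image g \<subseteq> F v" | "path_image g \<subseteq> ?G"
    using closed_curve_in_union_meeting_in_point[OF g] by metis
  then show ?case
  proof cases
    case 2
    have "\<exists>u\<in>?V. path_image g \<subseteq> F u"
    proof (rule Suc.hyps(1))
      show "\<nexists>p. graph_cycle ?V E p" using Suc.prems(2) by (auto simp: graph_cycle_def)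
    qed (use Suc.prems(1,3-5) Suc.hyps(2) v 2 in auto)
    then show ?thesis by blast
  qed (use v in blast)
qed

text \<open>The union along a path is connected because consecutive sets meet. Paths joining a fixed
  root \<open>r\<close> to every vertex give connected unions that all contain a point of
  \<open>F r\<close>.\<close>

lemma connected_Union_connected_graph:
  assumes "connected_graph V E" and ne: "\<And>u. u \<in> V \<Longrightarrow> F u \<noteq> {}"
    and conn: "\<And>u. u \<in> V \<Longrightarrow> connected (F u)"
    and meet: "\<And>u v. u \<in> V \<Longrightarrow> v \<in> V \<Longrightarrow> E u v \<Longrightarrow> F u \<inter> F v \<noteq> {}"
  shows "connected (\<Union>u\<in>V. F u)"
proof -
  have path: "connected (\<Union>u\<in>set p. F u)" if "set p \<subseteq> V" "successively E p" for p
    using that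
  proof (induction p)
    case (Cons u p)
    show ?case
    proof (cases p)
      case (Cons v q)
      then have "F u \<inter> F v \<noteq> {}" using Cons.prems meet by simp
      then have "F u \<inter> (\<Union>u\<in>set p. F u) \<noteq> {}" using Cons by auto
      moreover have "connected (\<Union>u\<in>set p. F u)" using Cons.IH Cons.prems Cons by auto
      moreover have "connected (F u)" using conn Cons.prems by simp
      ultimately show ?thesis using connected_Un[of "F u"] by simp
    qed (use Cons.prems conn in auto)
  qed simp
  obtain r where r: "r \<in> V" using assms(1) by (auto simp: connected_graph_def)
  then obtain a where a: "a \<in> F r" using ne by blast
  have "\<exists>p. r \<in> set p \<and> v \<in> set p \<and> set p \<subseteq> V \<and> successively E p" if "v \<in> V" for v
    using assms(1) r that unfolding connected_graph_def by (metis hd_in_set last_in_set)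
  then obtain p where p: "\<And>v. v \<in> V \<Longrightarrow> r \<in> set (p v) \<and> v \<in> set (p v) \<and> set (p v) \<subseteq> V \<and> successively E (p v)"
    by metis
  have "connected (\<Union>v\<in>V. \<Union>u\<in>set (p v). F u)"
  proof (rule connected_Union)
    show "\<Inter>((\<lambda>v. \<Union>u\<in>set (p v). F u) ` V) \<noteq> {}" using a p by blast
  qed (use p path in auto)
  also have "(\<Union>v\<in>V. \<Union>u\<in>set (p v). F u) = (\<Union>u\<in>V. F u)" using p by blast
  finally show ?thesis .
qed

text \<open>Connectedness im kleinen suffices. Deleting from \<open>X\<close> the finitely many
  closed members that miss \<open>x\<close> leaves a neighbourhood of \<open>x\<close>, each of
  whose points shares a small connected member with \<open>x\<close>.\<close>

lemma locally_connected_if_finite_small_covers: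
  fixes X :: "'a::metric_space set"
  assumes cover: "\<And>\<epsilon>. \<epsilon> > 0 \<Longrightarrow> \<exists>\<F>. finite \<F> \<and> X = \<Union>\<F> \<and>
      (\<forall>C\<in>\<F>. closed C \<and> connected C \<and> (\<forall>x\<in>C. \<forall>y\<in>C. dist x y \<le> \<epsilon>))"
  shows "locally connected X"
  unfolding locally_connected_im_kleinen
proof (intro allI impI, elim conjE)
  fix v x assume v: "openin (top_of_set X) v" "x \<in> v"
  then obtain e where e: "e > 0" "ball x e \<inter> X \<subseteq> v" by (auto simp: openin_contains_ball)
  \<comment> \<open>Half of \<open>e\<close>, since the bound on distances is not strict but the
    ball is open.\<close>
  then obtain \<F> where F: "finite \<F>" "X = \<Union>\<F>"
    "\<And>C. C \<in> \<F> \<Longrightarrow> closed C \<and> connected C \<and> (\<forall>x\<in>C. \<forall>y\<in>C. dist x y \<le> e / 2)"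
    using cover[of "e / 2"] by auto
  define u where "u = X - \<Union>{C \<in> \<F>. x \<notin> C}"
  have "closed (\<Union>{C \<in> \<F>. x \<notin> C})" using F by (intro closed_Union) auto
  then have "openin (top_of_set X) u"
    unfolding u_def by (simp add: Diff_eq openin_open_Int open_Compl)
  moreover have "x \<in> u" using v by (auto simp: u_def dest: openin_imp_subset)
  moreover have near: "\<exists>C\<in>\<F>. x \<in> C \<and> y \<in> C \<and> C \<subseteq> v" if "y \<in> u" for y
  proof -
    obtain C where C: "C \<in> \<F>" "y \<in> C" "x \<in> C" using \<open>y \<in> u\<close> F by (auto simp: u_def)
    have "C \<subseteq> ball x e"
    proof
      fix z assume "z \<in> C"
      then have "dist x z \<le> e / 2" using F C by blast
      then show "z \<in> ball x e" using e by simp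
    qed
    moreover have "C \<subseteq> X" using C F by blast
    ultimately have "C \<subseteq> v" using e by blast
    then show ?thesis using C by blast
  qed
  moreover have "u \<subseteq> v" using near by blast
  moreover have "\<forall>y. y \<in> u \<longrightarrow> (\<exists>c. connected c \<and> c \<subseteq> v \<and> x \<in> c \<and> y \<in> c)"
    using near F(3) by metis
  ultimately show "\<exists>u. openin (top_of_set X) u \<and> x \<in> u \<and> u \<subseteq> v \<and>
      (\<forall>y. y \<in> u \<longrightarrow> (\<exists>c. connected c \<and> c \<subseteq> v \<and> x \<in> c \<and> y \<in> c))"
    by (intro exI[of _ u]) simp
qed

section \<open>Self-similarity\<close>

text \<open>White is \<open>True\<close> and yellow is \<open>False\<close>.  An inverted triangle of one colour carries
  the pattern of the other colour, which is why \<open>hutch\<close> flips the colour there.\<close>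

definition ups :: "patterns \<Rightarrow> bool \<Rightarrow> triangle set" where
  "ups R c = (if c then white R else yellow R)"

definition downs :: "patterns \<Rightarrow> bool \<Rightarrow> triangle set" where
  "downs R c = (if c then white' R else yellow' R)"

definition hutch :: "patterns \<Rightarrow> (bool \<Rightarrow> (real^2) set) \<Rightarrow> bool \<Rightarrow> (real^2) set" where
  "hutch R X c = (\<Union>U\<in>ups R c. tri_map U ` X c) \<union> (\<Union>U\<in>downs R c. tri_map U ` X (\<not> c))"

lemma ups_refine: "ups (refine R S) c = substitute (ups R c) (ups S c) \<union> substitute (downs R c) (downs S (\<not> c))"
  by (simp add: ups_def downs_def refine_def)

lemma downs_refine: "downs (refine R S) c = substitute (ups R c) (downs S c) \<union> substitute (downs R c) (ups S (\<not> c))"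
  by (simp add: ups_def downs_def refine_def)

lemma Union_substitute:
  assumes "\<And>V. V \<in> B \<Longrightarrow> full V \<subseteq> full base" "X \<subseteq> full base"
  shows "(\<Union>T\<in>substitute A B. tri_map T ` X) = (\<Union>U\<in>A. tri_map U ` (\<Union>V\<in>B. tri_map V ` X))"
proof -
  have "tri_map (subtriangle U V) ` X = tri_map U ` tri_map V ` X" if "V \<in> B" for U V
    unfolding image_image
    by (rule image_cong) (use assms that in \<open>auto simp: tri_map_subtriangle\<close>)
  moreover have "(\<Union>T\<in>substitute A B. tri_map T ` X) = (\<Union>U\<in>A. \<Union>V\<in>B. tri_map (subtriangle U V) ` X)"
    unfolding substitute_def by fast
  ultimately show ?thesis by (simp add: image_UN)
qed

text \<open>Refinement of patterns becomes composition of operators. An inverted triangle inside an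
  inverted triangle is upright again, and correspondingly the two colour flips cancel.\<close>

lemma hutch_refine:
  assumes "\<And>V c. V \<in> ups S c \<union> downs S c \<Longrightarrow> full V \<subseteq> full base" "\<And>c. X c \<subseteq> full base"
  shows "hutch (refine R S) X c = hutch R (hutch S X) c"
proof -
  have sub: "(\<Union>T\<in>substitute A B. tri_map T ` X c) = (\<Union>U\<in>A. tri_map U ` (\<Union>V\<in>B. tri_map V ` X c))"
    if "B \<in> range (ups S) \<union> range (downs S)" for A B c
    using that assms by (intro Union_substitute) blast+
  show ?thesis
    unfolding hutch_def ups_refine downs_refine UN_Un
    by (simp add: sub image_Un UN_Un_distrib Un_ac)
qed

section \<open>Labyrinth systems and the recursion for their fractals\<close>

locale labyrinth =
  fixes m :: nat and S :: patterns
  assumes m: "m \<ge> 2" and labyrinth: "labyrinth_patterns_system m S"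
begin

definition cells :: "bool \<Rightarrow> triangle set" where
  "cells c = ups S c \<union> downs S c"

text \<open>Each iteration adds the new subdivision on the outside, whereas \<open>level\<close>
  subdivides the innermost triangles. The outer form exposes the self-similarity over the cells of
  \<open>S\<close>.\<close>

definition approx :: "nat \<Rightarrow> bool \<Rightarrow> (real^2) set" where
  "approx n = (hutch S ^^ n) (\<lambda>_. full base)"

definition fractal :: "bool \<Rightarrow> (real^2) set" where
  "fractal c = (\<Inter>n. approx n c)"

lemma ups_upright: "ups S c \<subseteq> upright m" and downs_inverted: "downs S c \<subseteq> inverted m"
  using labyrinth by (auto simp: labyrinth_patterns_system_def patterns_system_def ups_def downs_def)

lemma cells_subset: "cells c \<subseteq> upright m \<union> inverted m"
  using ups_upright downs_inverted unfolding cells_def by blast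

lemma full_cell_subset: "U \<in> cells c \<Longrightarrow> full U \<subseteq> full base"
  using full_subset_base cells_subset m by (metis in_mono not_less_eq_eq numeral_2_eq_2 le0 bot_nat_0.not_eq_extremum)

lemma tri_map_cell: "U \<in> cells c \<Longrightarrow> x \<in> full base \<Longrightarrow> tri_map U x \<in> full base"
  using full_cell_subset full_eq_image by blast

lemma finite_cells: "finite (cells c)"
proof -
  have "finite (indices s)" for s
  proof (rule finite_subset)
    show "indices s \<subseteq> (\<lambda>(a, b, c). vector [a, b, c]) ` ({0..s} \<times> {0..s} \<times> {0..s})"
    proof
      fix k assume k: "k \<in> indices s"
      have "k = vector [k $ 1, k $ 2, k $ 3]" by (simp add: vec_eq_iff forall_3)
      moreover have "k $ i \<in> {0..s}" for i
        using k exhaust_3[of i] by (auto simp: indices_def sum_3 forall_3)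
      ultimately show "k \<in> (\<lambda>(a, b, c). vector [a, b, c]) ` ({0..s} \<times> {0..s} \<times> {0..s})"
        by force
    qed
  qed auto
  then show ?thesis
    using finite_subset[OF cells_subset] by (simp add: upright_def inverted_def)
qed

lemma disjoint: "upright m \<inter> inverted m = {}"
  using upright_inverted_disjoint m by simp

text \<open>The colour of the pattern inside the cell \<open>U\<close> is \<open>c = (U \<in> upright m)\<close>.\<close>

lemma hutch_eq_cells: "hutch S X c = (\<Union>U\<in>cells c. tri_map U ` X (c = (U \<in> upright m)))"
proof -
  have "(c = (U \<in> upright m)) = c" if "U \<in> ups S c" for U using ups_upright that by blast
  then have "(\<Union>U\<in>ups S c. tri_map U ` X c) = (\<Union>U\<in>ups S c. tri_map U ` X (c = (U \<in> upright m)))"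
    by (intro SUP_cong) simp_all
  moreover have "(c = (U \<in> upright m)) = (\<not> c)" if "U \<in> downs S c" for U
    using downs_inverted disjoint that by blast
  then have "(\<Union>U\<in>downs S c. tri_map U ` X (\<not> c)) = (\<Union>U\<in>downs S c. tri_map U ` X (c = (U \<in> upright m)))"
    by (intro SUP_cong) simp_all
  ultimately show ?thesis by (simp add: hutch_def cells_def)
qed

lemma approx_0: "approx 0 c = full base"
  by (simp add: approx_def)

lemma approx_Suc: "approx (Suc n) c = (\<Union>U\<in>cells c. tri_map U ` approx n (c = (U \<in> upright m)))"
  by (simp add: approx_def hutch_eq_cells)

lemma approx_subset_base: "approx n c \<subseteq> full base"
  by (induction n arbitrary: c) (fastforce simp: approx_0 approx_Suc intro: tri_map_cell)+

lemma approx_antimono: "i \<le> j \<Longrightarrow> approx j c \<subseteq> approx i c"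
proof (rule lift_Suc_antimono_le[of "\<lambda>n. approx n c"])
  show "approx (Suc n) c \<subseteq> approx n c" for n
  proof (induction n arbitrary: c)
    case 0
    then show ?case using approx_0 approx_subset_base by simp
  next
    case (Suc n)
    then show ?case unfolding approx_Suc[of "Suc n"] approx_Suc[of n] by (intro UN_mono image_mono) auto
  qed
qed

lemma compact_approx: "compact (approx n c)"
proof (induction n arbitrary: c)
  case 0
  then show ?case by (simp add: approx_0 compact_convex_hull finite_imp_compact)
next
  case (Suc n)
  then show ?case unfolding approx_Suc
    by (intro compact_UN finite_cells compact_continuous_image
        continuous_on_subset[OF continuous_on_tri_map approx_subset_base])
qed

lemma level_approx: "hutch (level S (Suc n)) (\<lambda>_. full base) c = approx (Suc n) c"
proof -
  \<comment> \<open>Allowing any \<open>approx k\<close> as argument lets the induction move one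
    refinement at a time from the level to the argument.\<close>
  have "hutch (level S (Suc n)) (approx k) c = approx (Suc (n + k)) c" for k
  proof (induction n arbitrary: k)
    case 0
    then show ?case by (simp add: approx_def)
  next
    case (Suc n)
    have "hutch (level S (Suc (Suc n))) (approx k) c = hutch (level S (Suc n)) (hutch S (approx k)) c"
      unfolding level.simps
      by (rule hutch_refine) (use full_cell_subset approx_subset_base in \<open>auto simp: cells_def\<close>)
    also have "hutch S (approx k) = approx (Suc k)" by (simp add: approx_def)
    finally show ?case using Suc by simp
  qed
  from this[of 0] show ?thesis by (simp add: approx_0[abs_def] flip: approx_0)
qed

lemma Union_level: "(\<Union>U\<in>ups R c \<union> downs R c. full U) = hutch R (\<lambda>_. full base) c"
  unfolding hutch_def UN_Un by (simp flip: full_eq_image)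

lemma fractal_eq_INT_level: "(\<Inter>n\<in>{1..}. \<Union>U\<in>ups (level S n) c \<union> downs (level S n) c. full U) = fractal c"
proof -
  have "{1..} = range Suc" by (auto simp: image_iff dest: not0_implies_Suc)  (metis Suc_le_D)
  then have "(\<Inter>n\<in>{1..}. \<Union>U\<in>ups (level S n) c \<union> downs (level S n) c. full U) = (\<Inter>n. approx (Suc n) c)"
    unfolding Union_level by (simp add: level_approx image_image)
  \<comment> \<open>Stage 0, absent on the left, changes nothing because the approximations
    decrease.\<close>
  also have "\<dots> = fractal c"
    unfolding fractal_def using approx_antimono[OF le_SucI[OF order_refl]] by blast
  finally show ?thesis .
qed

lemma white_fractal_eq: "white_fractal S = fractal True"
  unfolding white_fractal_def by (simp add: ups_def downs_def flip: fractal_eq_INT_level)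

lemma yellow_fractal_eq: "yellow_fractal S = fractal False"
  unfolding yellow_fractal_def by (simp add: ups_def downs_def flip: fractal_eq_INT_level)

lemma fractal_subset_approx: "fractal c \<subseteq> approx n c"
  by (auto simp: fractal_def)

lemma fractal_subset_base: "fractal c \<subseteq> full base"
  using fractal_subset_approx approx_subset_base by blast

lemma compact_fractal: "compact (fractal c)"
  unfolding fractal_def using compact_approx by (intro compact_Inter) auto

definition piece :: "bool \<Rightarrow> triangle \<Rightarrow> (real^2) set" where
  "piece c U = tri_map U ` fractal (c = (U \<in> upright m))"

lemma compact_piece: "compact (piece c U)"
  unfolding piece_def using compact_fractal fractal_subset_base continuous_on_tri_map
  by (meson compact_continuous_image continuous_on_subset)

lemma dist_tri_map_cell:
  "U \<in> cells c \<Longrightarrow> x \<in> full base \<Longrightarrow> y \<in> full base \<Longrightarrow>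
    dist (tri_map U x) (tri_map U y) = dist x y / m"
  using dist_tri_map cells_subset by blast

lemma inj_on_tri_map_cell:
  assumes "U \<in> cells c" shows "inj_on (tri_map U) (full base)"
proof (rule inj_onI)
  fix x y assume "x \<in> full base" "y \<in> full base" "tri_map U x = tri_map U y"
  then have "dist x y / m = 0" using dist_tri_map_cell[OF assms, of x y] by simp
  then show "x = y" using m by simp
qed

text \<open>The intersection over the stages commutes with the union because there are finitely many
  cells and the stages decrease, and with the cell maps because these are injective.\<close>

lemma fractal_eq_pieces: "fractal c = (\<Union>U\<in>cells c. piece c U)"
proof
  show "(\<Union>U\<in>cells c. piece c U) \<subseteq> fractal c"
  proof -
    have "piece c U \<subseteq> approx n c" if "U \<in> cells c" for n U
    proof -
      have "piece c U \<subseteq> approx (Suc n) c"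
        unfolding approx_Suc piece_def using that fractal_subset_approx by blast
      then show ?thesis using approx_antimono[of n "Suc n" c] by auto
    qed
    then show ?thesis unfolding fractal_def by blast
  qed
next
  show "fractal c \<subseteq> (\<Union>U\<in>cells c. piece c U)"
  proof
    fix x assume x: "x \<in> fractal c"
    let ?A = "\<lambda>U n. tri_map U ` approx n (c = (U \<in> upright m))"
    have "\<exists>U\<in>cells c. \<forall>n. x \<in> ?A U n"
    proof (rule ccontr)
      assume "\<not> ?thesis"
      \<comment> \<open>If \<open>x\<close> left the image of every cell at some stage, it would
        have left all of them at the largest such stage \<open>M\<close>, contradicting membership
        in \<open>approx (Suc M) c\<close>.\<close>
      then obtain N where N: "\<And>U. U \<in> cells c \<Longrightarrow> x \<notin> ?A U (N U)" by metis
      define M where "M = Max (insert 0 (N ` cells c))"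
      have "N U \<le> M" if "U \<in> cells c" for U
        unfolding M_def using that finite_cells by (intro Max_ge) auto
      then have "x \<notin> ?A U M" if "U \<in> cells c" for U
        using N[OF that] approx_antimono[of "N U" M] that by blast
      moreover have "x \<in> approx (Suc M) c" using x fractal_subset_approx by blast
      ultimately show False unfolding approx_Suc by blast
    qed
    then obtain U where U: "U \<in> cells c" "\<And>n. x \<in> ?A U n" by blast
    then obtain y where y: "\<And>n. y n \<in> approx n (c = (U \<in> upright m))" "\<And>n. x = tri_map U (y n)"
      unfolding image_iff by metis
    \<comment> \<open>The preimages were chosen stage by stage; injectivity makes them one point,
      which then lies in every approximation.\<close>
    have "y n = y 0" for n
      using inj_onD[OF inj_on_tri_map_cell[OF U(1)]] y approx_subset_base by (metis subsetD)
    then have "y 0 \<in> fractal (c = (U \<in> upright m))" using y unfolding fractal_def by (metis INT_I)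
    then show "x \<in> (\<Union>U\<in>cells c. piece c U)" using U y unfolding piece_def by blast
  qed
qed

section \<open>Intersections of pieces\<close>

lemma m_pos: "m > 0"
  using m by simp

lemma bary_fractal: "x \<in> fractal c \<Longrightarrow> 0 \<le> bary x $ i" "x \<in> fractal c \<Longrightarrow> bary x $ i \<le> 1"
  using fractal_subset_base bary_nonneg bary_le_1 by blast+

lemma fractal_vertex: "x \<in> fractal c \<Longrightarrow> bary x $ i = 1 \<Longrightarrow> base $ i \<in> fractal c"
  using eq_base_if_bary_1 fractal_subset_base by blast

lemma piece_up:
  assumes "k \<in> indices (int m - 1)" "up_tri m k \<in> ups S c" "x \<in> piece c (up_tri m k)"
  obtains y where "y \<in> fractal c" "x = tri_map (up_tri m k) y" "\<And>i. m * bary x $ i = k $ i + bary y $ i"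
proof -
  have "up_tri m k \<in> upright m" using assms(2) ups_upright by blast
  then obtain y where y: "y \<in> fractal c" "x = tri_map (up_tri m k) y"
    using assms(3) by (auto simp: piece_def)
  then show thesis using that m_pos bary_tri_map_up assms(1) fractal_subset_base by fastforce
qed

lemma piece_down:
  assumes "k \<in> indices (int m - 2)" "down_tri m k \<in> downs S c" "x \<in> piece c (down_tri m k)"
  obtains y where "y \<in> fractal (\<not> c)" "x = tri_map (down_tri m k) y"
    "\<And>i. m * bary x $ i = k $ i + 1 - bary y $ i"
proof -
  have "down_tri m k \<notin> upright m" using assms(2) downs_inverted disjoint by blast
  then obtain y where y: "y \<in> fractal (\<not> c)" "x = tri_map (down_tri m k) y"
    using assms(3) by (auto simp: piece_def)
  then show thesis using that m_pos bary_tri_map_down assms(1) fractal_subset_base by fastforce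
qed

lemma cell_cases:
  assumes "U \<in> cells c"
  obtains (up) k where "k \<in> indices (int m - 1)" "U = up_tri m k" "U \<in> ups S c"
  | (down) k where "k \<in> indices (int m - 2)" "U = down_tri m k" "U \<in> downs S c"
  using assms ups_upright downs_inverted unfolding cells_def upright_def inverted_def by blast

lemma fractal_cases:
  assumes "x \<in> fractal c"
  obtains (up) k y where "k \<in> indices (int m - 1)" "up_tri m k \<in> ups S c" "y \<in> fractal c"
      "\<And>i. m * bary x $ i = k $ i + bary y $ i"
  | (down) k y where "k \<in> indices (int m - 2)" "down_tri m k \<in> downs S c" "y \<in> fractal (\<not> c)"
      "\<And>i. m * bary x $ i = k $ i + 1 - bary y $ i"
proof -
  obtain U where U: "U \<in> cells c" "x \<in> piece c U" using assms fractal_eq_pieces by blast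
  from U(1) show thesis
  proof (cases rule: cell_cases)
    case (up k)
    then show thesis using piece_up[of k c x] U(2) that(1) by blast
  next
    case (down k)
    then show thesis using piece_down[of k c x] U(2) that(2) by blast
  qed
qed

section \<open>Vertices of the base triangle in the fractals\<close>

definition corner_index :: "3 \<Rightarrow> int^3" where
  "corner_index i = (\<chi> j. if j = i then int m - 1 else 0)"

lemma corner_index_mem: "corner_index i \<in> indices (int m - 1)"
  using exhaust_3[of i] m by (auto simp: corner_index_def indices_def sum_3)

lemma base_mem_base: "base $ i \<in> full base"
  by (simp add: mem_base_iff bary_base axis_def)

lemma bary_corner:
  "bary (tri_map (up_tri m (corner_index i)) (base $ j)) $ l =
    ((if l = i then real m - 1 else 0) + (if l = j then 1 else 0)) / m"
  by (subst bary_tri_map_up[OF base_mem_base corner_index_mem m_pos])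
    (simp add: bary_base corner_index_def axis_def)

text \<open>At vertex \<open>i\<close> the scaled coordinate is \<open>m\<close>. An upright cell
  reaches this only with digit \<open>m - 1\<close>, so it is the corner cell; inverted cells have
  digits at most \<open>m - 2\<close> and never reach it.\<close>

lemma corner_triangle:
  assumes "base $ i \<in> fractal c"
  shows "up_tri m (corner_index i) \<in> corner_triangles (ups S c)"
  using assms
proof (cases rule: fractal_cases)
  case (up k y)
  have "real m = k $ i + bary y $ i" using up(4)[of i] by (simp add: bary_base axis_def)
  then have "real m - 1 \<le> k $ i" using bary_fractal(2)[OF up(3), of i] by linarith
  then have ki: "k $ i \<ge> int m - 1" by linarith
  have "k = corner_index i"
    using ki up(1) exhaust_3[of i]
    by (auto simp: corner_index_def indices_def sum_3 vec_eq_iff forall_3)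
  moreover have "bary (tri_map (up_tri m (corner_index i)) (base $ i)) = bary (base $ i)"
    using m_pos by (simp add: vec_eq_iff bary_corner bary_base axis_def)
  then have "base $ i \<in> full (up_tri m (corner_index i))"
    unfolding full_eq_image[of "up_tri _ _"] using base_mem_base by (metis bary_inject imageI)
  ultimately show ?thesis using up(2) by (auto simp: corner_triangles_def)
next
  case (down k y)
  have "real m = k $ i + 1 - bary y $ i" using down(4)[of i] by (simp add: bary_base axis_def)
  then have "real m \<le> k $ i + 1" using bary_fractal(1)[OF down(3), of i] by linarith
  then have "k $ i \<ge> int m - 1" by linarith
  moreover have "k $ i \<le> int m - 2"
    using down(1) exhaust_3[of i] by (auto simp: indices_def sum_3 forall_3)
  ultimately show ?thesis by simp
qed

lemma corner_index_inj:
  assumes "up_tri m (corner_index i) = up_tri m (corner_index j)" shows "i = j"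
proof (rule ccontr)
  assume "i \<noteq> j"
  have "bary (tri_map (up_tri m (corner_index i)) (base $ i)) $ i = 1"
    "bary (tri_map (up_tri m (corner_index j)) (base $ i)) $ i = 1 / m"
    using m_pos \<open>i \<noteq> j\<close> by (simp_all add: bary_corner)
  then show False using assms m by simp
qed

text \<open>The corners property transferred to the fractals. One direction says that a fractal
  contains at most one vertex, the other that the two fractals share none. Later contradictions
  about corners all go through this form.\<close>

lemma corner_unique:
  assumes "base $ i \<in> fractal c" "base $ j \<in> fractal d"
  shows "c = d \<longleftrightarrow> i = j"
proof
  have corners: "corners_property S" using labyrinth by (simp add: labyrinth_patterns_system_def)
  note tri = assms[THEN corner_triangle]
  show "i = j" if "c = d"
    using corners tri that by (intro corner_index_inj) (auto simp: corners_property_def ups_def split: if_splits)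
  show "c = d" if "i = j"
  proof (rule ccontr)
    assume "c \<noteq> d"
    then show False using corners tri that by (auto simp: corners_property_def ups_def split: if_splits)
  qed
qed

section \<open>Exit cells on the sides\<close>

definition exit_pair :: "bool \<Rightarrow> 3 \<Rightarrow> int^3 \<Rightarrow> int^3 \<Rightarrow> bool" where
  "exit_pair c i k k' \<longleftrightarrow> k \<in> indices (int m - 1) \<and> k' \<in> indices (int m - 1) \<and>
     k $ i = 0 \<and> k' $ i = 0 \<and> (\<forall>j. j \<noteq> i \<longrightarrow> k $ j + k' $ j = int m - 1) \<and>
     up_tri m k \<in> ups S c \<and> up_tri m k' \<in> ups S (\<not> c)"

lemma exit_pair_sym: "exit_pair c i k k' \<Longrightarrow> exit_pair (\<not> c) i k' k"
  by (simp add: exit_pair_def add.commute)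

text \<open>Enumerates the upright cells along side \<open>i\<close> by one number. The case
  distinction reproduces the order of entries used in \<open>exits_property\<close>.\<close>

definition side_index :: "3 \<Rightarrow> int \<Rightarrow> int^3" where
  "side_index i a = (\<chi> j. if j = i then 0 else if j = (if i = 1 then 2 else 1) then a else int m - 1 - a)"

lemma side_index_vector:
  "side_index 1 a = vector [0, a, int m - 1 - a]"
  "side_index 2 a = vector [a, 0, int m - 1 - a]"
  "side_index 3 a = vector [a, int m - 1 - a, 0]"
  by (simp_all add: side_index_def vec_eq_iff forall_3)

lemma side_index_mem: "a \<in> {0..int m - 1} \<Longrightarrow> side_index i a \<in> indices (int m - 1)"
  using exhaust_3[of i] by (auto simp: side_index_vector indices_def sum_3 forall_3)

lemma side_indexE:
  assumes "k \<in> indices (int m - 1)" "k $ i = 0"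
  obtains a where "a \<in> {0..int m - 1}" "k = side_index i a"
proof -
  have "k = side_index i (k $ (if i = 1 then 2 else 1))"
    using assms exhaust_3[of i] by (auto simp: side_index_vector indices_def sum_3 vec_eq_iff forall_3)
  moreover have "k $ j \<in> {0..int m - 1}" for j
    using assms(1) exhaust_3[of j] by (auto simp: indices_def sum_3 forall_3)
  ultimately show thesis using that by blast
qed

lemma exit_pair_iff:
  "exit_pair True i k k' \<longleftrightarrow> (\<exists>a\<in>{0..int m - 1}. k = side_index i a \<and> k' = side_index i (int m - 1 - a) \<and>
     up_tri m (side_index i a) \<in> white S \<and> up_tri m (side_index i (int m - 1 - a)) \<in> yellow S)"
proof
  assume pair: "exit_pair True i k k'"
  then obtain a a' where a: "a \<in> {0..int m - 1}" "k = side_index i a" "k' = side_index i a'"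
    using side_indexE unfolding exit_pair_def by metis
  have "k $ (if i = 1 then 2 else 1) + k' $ (if i = 1 then 2 else 1) = int m - 1"
    using pair by (auto simp: exit_pair_def)
  then have "a' = int m - 1 - a" by (auto simp: a side_index_def split: if_splits)
  then show "\<exists>a\<in>{0..int m - 1}. k = side_index i a \<and> k' = side_index i (int m - 1 - a) \<and>
     up_tri m (side_index i a) \<in> white S \<and> up_tri m (side_index i (int m - 1 - a)) \<in> yellow S"
    using pair a by (auto simp: exit_pair_def ups_def)
qed (auto simp: exit_pair_def ups_def side_index_mem, simp_all add: side_index_def)

text \<open>The exits property asserts uniqueness of a whole triple. Its conditions constrain the
  three entries separately, so replacing a single entry of the valid triple yields uniqueness on
  each side.\<close>

lemma white_exit_pairs: "\<exists>k k'. exit_pair True i k k' \<and> (\<forall>l l'. exit_pair True i l l' \<longrightarrow> l = k \<and> l' = k')"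
proof -
  define Q where "Q i a \<longleftrightarrow> a \<in> {0..int m - 1} \<and> up_tri m (side_index i a) \<in> white S \<and>
    up_tri m (side_index i (int m - 1 - a)) \<in> yellow S" for i a
  have "exits_property m S" using labyrinth by (simp add: labyrinth_patterns_system_def)
  then have "\<exists>!k::int^3. \<forall>i. Q i (k $ i)"
    unfolding exits_property_def Q_def forall_3 side_index_vector by (simp add: conj_commute conj_left_commute)
  then obtain k :: "int^3" where k: "\<And>i. Q i (k $ i)" and uniq: "\<And>l::int^3. (\<forall>i. Q i (l $ i)) \<Longrightarrow> l = k"
    by metis
  have "a = k $ i" if "Q i a" for a
  proof -
    have "(\<chi> j. if j = i then a else k $ j) = k" using that k by (intro uniq) simp
    then show ?thesis by (auto simp: vec_eq_iff dest: spec[of _ i])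
  qed
  then show ?thesis
    using k[of i] unfolding exit_pair_iff Q_def by metis
qed

lemma exit_pair_exists: "\<exists>k k'. exit_pair c i k k'"
proof -
  obtain k k' where k: "exit_pair True i k k'" using white_exit_pairs by metis
  show ?thesis using k exit_pair_sym[OF k] by (cases c) auto
qed

lemma exit_pair_unique:
  assumes "exit_pair c i k k'" "exit_pair c i l l'"
  shows "k = l"
proof (cases c)
  case True
  then show ?thesis using white_exit_pairs[of i] assms by metis
next
  case False
  then have "exit_pair True i k' k" "exit_pair True i l' l"
    using assms[THEN exit_pair_sym] by simp_all
  then show ?thesis using white_exit_pairs[of i] by metis
qed

text \<open>The cell map fixes \<open>x\<close>, as dividing \<open>k + k / (m - 1)\<close> by
  \<open>m\<close> gives \<open>k / (m - 1)\<close> again. An upright cell keeps the colour, so the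
  fixed point survives every iteration.\<close>

lemma fixed_point_mem_fractal:
  assumes k: "k \<in> indices (int m - 1)" "up_tri m k \<in> ups S c"
    and x: "\<And>j. bary x $ j = k $ j / (m - 1)"
  shows "x \<in> fractal c"
proof -
  have "x \<in> full base" using k m by (simp add: mem_base_iff x indices_def)
  have fixed: "tri_map (up_tri m k) x = x"
  proof -
    have "(k $ j + bary x $ j) / m = bary x $ j" for j
      using m by (simp add: x field_simps of_nat_diff)
    then have "bary (tri_map (up_tri m k) x) = bary x"
      using bary_tri_map_up[OF \<open>x \<in> full base\<close> k(1) m_pos] by (simp add: vec_eq_iff)
    then show ?thesis by (simp add: bary_inject)
  qed
  have "x \<in> approx n c" for n
  proof (induction n)
    case 0
    then show ?case using \<open>x \<in> full base\<close> by (simp add: approx_0)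
  next
    case (Suc n)
    have "up_tri m k \<in> cells c" "up_tri m k \<in> upright m" using k ups_upright by (auto simp: cells_def)
    then have "tri_map (up_tri m k) x \<in> approx (Suc n) c"
      unfolding approx_Suc using Suc by (intro UN_I[of "up_tri m k"] imageI) simp_all
    then show ?case by (simp add: fixed)
  qed
  then show ?thesis by (simp add: fractal_def)
qed

section \<open>Mirror points of the two fractals on a side\<close>

definition side_pair :: "bool \<Rightarrow> 3 \<Rightarrow> real^2 \<Rightarrow> real^2 \<Rightarrow> bool" where
  "side_pair c i x x' \<longleftrightarrow> x \<in> fractal c \<and> x' \<in> fractal (\<not> c) \<and> bary x $ i = 0 \<and> bary x' $ i = 0 \<and>
     (\<forall>j. j \<noteq> i \<longrightarrow> bary x $ j + bary x' $ j = 1)"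

lemma side_pair_sym: "side_pair c i x x' \<Longrightarrow> side_pair (\<not> c) i x' x"
  by (simp add: side_pair_def add.commute)

text \<open>The fixed points of the exit cells form a side pair.\<close>

lemma side_pair_exists: "\<exists>x x'. side_pair c i x x'"
proof -
  obtain k k' where kk: "exit_pair c i k k'" using exit_pair_exists by blast
  define p where "p l = comb (\<chi> j. real_of_int (l $ j) / (m - 1)) base" for l :: "int^3"
  have p: "bary (p l) $ j = l $ j / (m - 1)" if "l \<in> indices (int m - 1)" for l j
  proof -
    have "l $ 1 + l $ 2 + l $ 3 = int m - 1" using that by (simp add: indices_def sum_3)
    then have "real_of_int (l $ 1 + l $ 2 + l $ 3) = real (m - 1)" using m by simp
    then have "(\<Sum>j\<in>UNIV. (\<chi> j. real_of_int (l $ j) / (m - 1)) $ j) = 1"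
      using m by (simp add: sum_3 flip: add_divide_distrib)
    then show ?thesis unfolding p_def by (subst bary_comb) simp_all
  qed
  have k: "k \<in> indices (int m - 1)" "k' \<in> indices (int m - 1)" using kk by (auto simp: exit_pair_def)
  have "bary (p k) $ j + bary (p k') $ j = 1" if "j \<noteq> i" for j
  proof -
    have "k $ j + k' $ j = int m - 1" using kk that by (simp add: exit_pair_def)
    then have "real_of_int (k $ j + k' $ j) = real (m - 1)" using m by simp
    then show ?thesis using m by (simp add: p k flip: add_divide_distrib)
  qed
  moreover have "p k \<in> fractal c" "p k' \<in> fractal (\<not> c)"
    using kk fixed_point_mem_fractal p by (auto simp: exit_pair_def)
  ultimately have "side_pair c i (p k) (p k')"
    using kk k by (simp add: side_pair_def p exit_pair_def)
  then show ?thesis by blast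
qed

text \<open>An inverted cell can touch side \<open>i\<close> only at the image of vertex
  \<open>i\<close>, which puts that vertex into the fractal of colour \<open>\<not> c\<close>. An
  upright cell for \<open>x'\<close> would then give this fractal a second vertex, and an inverted
  one would put vertex \<open>i\<close> into both fractals.\<close>

lemma side_pair_up:
  assumes "side_pair c i x x'"
  obtains k y where "k \<in> indices (int m - 1)" "up_tri m k \<in> ups S c" "y \<in> fractal c"
      "\<And>i. m * bary x $ i = k $ i + bary y $ i"
proof -
  have x: "x \<in> fractal c" "x' \<in> fractal (\<not> c)" "bary x $ i = 0" "bary x' $ i = 0"
    and sum: "\<And>j. j \<noteq> i \<Longrightarrow> bary x $ j + bary x' $ j = 1"
    using assms by (auto simp: side_pair_def)
  have mx: "m * bary x $ i = 0" "m * bary x' $ i = 0" using x by simp_all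
  from x(1) show thesis
  proof (cases rule: fractal_cases)
    case (down k y)
    have "real_of_int (k $ i) \<ge> 0" using down by (simp add: indices_def)
    then have yi: "bary y $ i = 1" using bary_fractal(2)[OF down(3), of i] down(4)[of i] mx(1) by linarith
    then have corner: "base $ i \<in> fractal (\<not> c)" using fractal_vertex down by blast
    from x(2) show thesis
    proof (cases rule: fractal_cases)
      case up: (up k' y')
      obtain j l where jl: "UNIV = {i, j, l}" "i \<noteq> j" "i \<noteq> l" "j \<noteq> l" by (rule index_3_others)
      have "real_of_int (k' $ i) \<ge> 0" using up by (simp add: indices_def)
      then have y'i: "bary y' $ i = 0" using bary_fractal(1)[OF up(3), of i] up(4)[of i] mx(2) by linarith
      have yj: "bary y $ j = 0"
        using sum_bary_others[OF jl, of y] bary_fractal(1)[OF down(3)] yi by (smt (verit))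
      have "real m * (bary x $ j + bary x' $ j) = k $ j + 1 + k' $ j + bary y' $ j"
        using up(4)[of j] down(4)[of j] yj by (simp add: algebra_simps)
      \<comment> \<open>The coordinate is an integer between 0 and 1, and the one at
        \<open>i\<close> vanishes; hence \<open>y'\<close> is vertex \<open>j\<close> or vertex
        \<open>l\<close>.\<close>
      then have "bary y' $ j = real_of_int (int m - k $ j - 1 - k' $ j)" using sum[of j] jl by simp
      then obtain n :: int where n: "bary y' $ j = n" by blast
      then have "0 \<le> n" "n \<le> 1" using bary_fractal[OF up(3), of j] by auto
      then consider "bary y' $ j = 1" | "bary y' $ l = 1"
        using n sum_bary_others[OF jl, of y'] y'i by fastforce
      then show thesis
        using corner_unique[OF corner, of j "\<not> c"] corner_unique[OF corner, of l "\<not> c"]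
          fractal_vertex[OF up(3)] jl by cases auto
    next
      case down': (down k' y')
      have "real_of_int (k' $ i) \<ge> 0" using down' by (simp add: indices_def)
      then have "bary y' $ i = 1" using bary_fractal(2)[OF down'(3), of i] down'(4)[of i] mx(2) by linarith
      then have "base $ i \<in> fractal c" using fractal_vertex[OF down'(3)] by simp
      then show thesis using corner_unique[OF corner, of i c] by simp
    qed
  qed (use that in blast)
qed

text \<open>Both points lie in upright cells. Off \<open>i\<close>, the coordinates of the blown-up
  points add up to an integer between 0 and 2. The values 0 and 2 would make both points the same
  vertex, so the sum is 1 and the digits are those of an exit pair.\<close>

lemma side_pair_step:
  assumes pair: "side_pair c i x x'"
  obtains k k' y y' where "exit_pair c i k k'" "side_pair c i y y'" "\<And>j. m * bary x $ j = k $ j + bary y $ j"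
proof -
  obtain k y where up: "k \<in> indices (int m - 1)" "up_tri m k \<in> ups S c" "y \<in> fractal c"
      "\<And>i. m * bary x $ i = k $ i + bary y $ i"
    using side_pair_up[OF pair] by blast
  obtain k' y' where up': "k' \<in> indices (int m - 1)" "up_tri m k' \<in> ups S (\<not> c)" "y' \<in> fractal (\<not> c)"
      "\<And>i. m * bary x' $ i = k' $ i + bary y' $ i"
    using side_pair_up[OF side_pair_sym[OF pair]] by blast
  have "real_of_int (k $ i) \<ge> 0" "real_of_int (k' $ i) \<ge> 0" "m * bary x $ i = 0" "m * bary x' $ i = 0"
    using up(1) up'(1) pair by (auto simp: indices_def side_pair_def)
  then have "real_of_int (k $ i) = 0 \<and> real_of_int (k' $ i) = 0 \<and> bary y $ i = 0 \<and> bary y' $ i = 0"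
    using up(4)[of i] up'(4)[of i] bary_fractal(1)[OF up(3), of i] bary_fractal(1)[OF up'(3), of i]
    by linarith
  then have i0: "k $ i = 0" "k' $ i = 0" "bary y $ i = 0" "bary y' $ i = 0" by simp_all
  have no2: False if "bary y $ j = 1" "bary y' $ j = 1" for j
    using corner_unique[of j c j "\<not> c"] fractal_vertex up(3) up'(3) that by blast
  have sum: "k $ j + k' $ j = int m - 1 \<and> bary y $ j + bary y' $ j = 1" if "j \<noteq> i" for j
  proof -
    obtain l where jl: "UNIV = {i, j, l}" "i \<noteq> j" "i \<noteq> l" "j \<noteq> l"
      using index_3_third[OF \<open>j \<noteq> i\<close>] by blast
    have "real m * (bary x $ j + bary x' $ j) = k $ j + k' $ j + (bary y $ j + bary y' $ j)"
      using up(4)[of j] up'(4)[of j] by (simp add: algebra_simps)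
    then have eq: "bary y $ j + bary y' $ j = real_of_int (int m - k $ j - k' $ j)"
      using pair that by (simp add: side_pair_def)
    define n where "n = int m - k $ j - k' $ j"
    have bounds: "0 \<le> bary y $ j" "bary y $ j \<le> 1" "0 \<le> bary y' $ j" "bary y' $ j \<le> 1"
      using bary_fractal up(3) up'(3) by blast+
    then have "0 \<le> real_of_int n" "real_of_int n \<le> 2" using eq unfolding n_def by linarith+
    then have "0 \<le> n" "n \<le> 2" by simp_all
    moreover have "n \<noteq> 2"
      using no2[of j] bounds eq by (auto simp: n_def)
    moreover have "n \<noteq> 0"
    proof
      assume "n = 0"
      then have "bary y $ j = 0" "bary y' $ j = 0" using bounds eq unfolding n_def by linarith+
      then have "bary y $ l = 1" "bary y' $ l = 1"
        using sum_bary_others[OF jl, of y] sum_bary_others[OF jl, of y'] i0 by linarith+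
      then show False using no2 by blast
    qed
    ultimately have "n = 1" by linarith
    then show ?thesis using eq unfolding n_def by simp
  qed
  have "exit_pair c i k k'" using up up' i0 sum by (simp add: exit_pair_def)
  moreover have "side_pair c i y y'" using up up' i0 sum by (simp add: side_pair_def)
  ultimately show thesis using that up(4) by blast
qed

text \<open>Uniqueness of the exit cells makes the leading digits of both points equal at every
  blow-up, so their coordinates differ by at most \<open>(1 / m) ^ n\<close> for all
  \<open>n\<close>.\<close>

lemma side_pair_unique:
  assumes "side_pair c i x x'" "side_pair c i z z'"
  shows "x = z"
proof -
  have close: "\<bar>bary x $ j - bary z $ j\<bar> \<le> (1 / m) ^ n" for n j
    using assms
  proof (induction n arbitrary: x x' z z')
    case 0
    then have "x \<in> fractal c" "z \<in> fractal c" by (auto simp: side_pair_def)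
    then show ?case
      using bary_fractal[of x c j] bary_fractal[of z c j] by (simp add: abs_le_iff)
  next
    case (Suc n)
    obtain k k' y y' where k: "exit_pair c i k k'" "side_pair c i y y'" "m * bary x $ j = k $ j + bary y $ j"
      using side_pair_step[OF Suc.prems(1)] by metis
    obtain l l' w w' where l: "exit_pair c i l l'" "side_pair c i w w'" "m * bary z $ j = l $ j + bary w $ j"
      using side_pair_step[OF Suc.prems(2)] by metis
    have "k = l" using exit_pair_unique k(1) l(1) by blast
    then have "bary x $ j - bary z $ j = (bary y $ j - bary w $ j) / m"
      using k(3) l(3) m_pos by (simp add: field_simps)
    then have "\<bar>bary x $ j - bary z $ j\<bar> = \<bar>bary y $ j - bary w $ j\<bar> * (1 / m)" by simp
    also have "\<dots> \<le> (1 / m) ^ n * (1 / m)" using Suc.IH[OF k(2) l(2)] by (intro mult_right_mono) simp_all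
    finally show ?case by simp
  qed
  have "(\<lambda>n. (1 / real m) ^ n) \<longlonglongrightarrow> 0" using m by (intro LIMSEQ_power_zero) simp
  then have "\<bar>bary x $ j - bary z $ j\<bar> \<le> 0" for j
    using close by (intro LIMSEQ_le_const[of "\<lambda>n. (1 / real m) ^ n"]) auto
  then have "bary x = bary z" by (simp add: vec_eq_iff)
  then show ?thesis by (simp add: bary_inject)
qed

section \<open>How the pieces meet\<close>

lemma eq_if_bary_diff_int:
  assumes "x \<in> fractal c" "y \<in> fractal c" "\<And>i. bary x $ i - bary y $ i = of_int (n i)"
  shows "x = y"
proof (rule ccontr)
  assume "x \<noteq> y"
  have sum: "n 1 + n 2 + n 3 = 0"
  proof -
    have "real_of_int (n 1 + n 2 + n 3) = 0"
      using sum_bary[of x] sum_bary[of y] by (simp flip: assms(3))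
    then show ?thesis by linarith
  qed
  have "\<exists>i. n i \<noteq> 0" using \<open>x \<noteq> y\<close> assms(3) by (metis bary_inject eq_iff_diff_eq_0 of_int_0 vec_eq_iff)
  \<comment> \<open>The differences sum to 0, so both signs occur. As coordinates lie between 0 and
    1, a positive difference makes \<open>x\<close> vertex \<open>i\<close> and a negative one makes
    \<open>y\<close> vertex \<open>j\<close>, two different vertices in one fractal.\<close>
  then have "(\<exists>i. n i > 0) \<and> (\<exists>j. n j < 0)"
    using sum unfolding exists_3 by linarith
  then obtain i j where ij: "n i > 0" "n j < 0" by blast
  have "bary x $ i = 1"
    using ij(1) assms(3)[of i] bary_fractal(2)[OF assms(1), of i] bary_fractal(1)[OF assms(2), of i] by linarith
  moreover have "bary y $ j = 1"
    using ij(2) assms(3)[of j] bary_fractal(1)[OF assms(1), of j] bary_fractal(2)[OF assms(2), of j] by linarith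
  ultimately have "i = j" using corner_unique[of i c j c] fractal_vertex assms by blast
  then show False using ij by simp
qed

text \<open>The sums \<open>n i\<close> of corresponding coordinates are integers between 0 and 2,
  and 2 would mean a vertex common to both fractals. Since they total 2, exactly one vanishes, and
  its index is the label of the shared side.\<close>

lemma up_down_meet:
  assumes k: "k \<in> indices (int m - 1)" "k' \<in> indices (int m - 2)"
    and y: "y \<in> fractal c" "y' \<in> fractal (\<not> c)"
    and eq: "\<And>i. k $ i + bary y $ i = k' $ i + 1 - bary y' $ i"
  obtains j where "k $ j = k' $ j + 1" "\<And>i. i \<noteq> j \<Longrightarrow> k $ i = k' $ i" "side_pair c j y y'"
proof -
  define n where "n i = k' $ i + 1 - k $ i" for i
  have n: "real_of_int (n i) = bary y $ i + bary y' $ i" for i using eq[of i] by (simp add: n_def)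
  have sum: "n 1 + n 2 + n 3 = 2" using k by (simp add: n_def indices_def sum_3)
  have "n i = 0 \<or> n i = 1" for i
  proof -
    have b: "0 \<le> bary y $ i" "bary y $ i \<le> 1" "0 \<le> bary y' $ i" "bary y' $ i \<le> 1"
      using bary_fractal y by blast+
    then have "0 \<le> real_of_int (n i)" "real_of_int (n i) \<le> 2" using n[of i] by linarith+
    then have "0 \<le> n i" "n i \<le> 2" by simp_all
    moreover have "n i \<noteq> 2"
    proof
      assume "n i = 2"
      then have "bary y $ i = 1" "bary y' $ i = 1" using n[of i] b by auto
      then show False using corner_unique[of i c i "\<not> c"] fractal_vertex y by blast
    qed
    ultimately show ?thesis by linarith
  qed
  then have n01: "n 1 = 0 \<or> n 1 = 1" "n 2 = 0 \<or> n 2 = 1" "n 3 = 0 \<or> n 3 = 1" by blast+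
  then have "\<exists>j. n j = 0 \<and> (\<forall>i. i \<noteq> j \<longrightarrow> n i = 1)"
    using sum unfolding exists_3 forall_3 by auto
  then obtain j where j: "n j = 0" "\<And>i. i \<noteq> j \<Longrightarrow> n i = 1" by blast
  have "bary y $ j = 0" "bary y' $ j = 0"
    using n[of j] j(1) bary_fractal(1)[OF y(1), of j] bary_fractal(1)[OF y(2), of j] by auto
  moreover have "bary y $ i + bary y' $ i = 1" if "i \<noteq> j" for i
    using n[of i] j(2)[OF that] by simp
  ultimately have "side_pair c j y y'" using y by (simp add: side_pair_def)
  moreover have "k $ j = k' $ j + 1" using j(1) by (simp add: n_def)
  moreover have "k $ i = k' $ i" if "i \<noteq> j" for i using j(2)[OF that] by (simp add: n_def)
  ultimately show thesis using that by blast
qed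

lemma piece_up_down_meet:
  assumes "k \<in> indices (int m - 1)" "up_tri m k \<in> ups S c"
    and "k' \<in> indices (int m - 2)" "down_tri m k' \<in> downs S c"
    and x: "x \<in> piece c (up_tri m k)" "x \<in> piece c (down_tri m k')"
  obtains j y y' where "k $ j = k' $ j + 1" "\<And>i. i \<noteq> j \<Longrightarrow> k $ i = k' $ i" "side_pair c j y y'"
    "x = tri_map (up_tri m k) y"
proof -
  obtain y where y: "y \<in> fractal c" "x = tri_map (up_tri m k) y" "\<And>i. m * bary x $ i = k $ i + bary y $ i"
    using piece_up assms by blast
  obtain y' where y': "y' \<in> fractal (\<not> c)" "\<And>i. m * bary x $ i = k' $ i + 1 - bary y' $ i"
    using piece_down assms by blast
  have "k $ i + bary y $ i = k' $ i + 1 - bary y' $ i" for i using y(3)[of i] y'(2)[of i] by simp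
  then obtain j where j: "k $ j = k' $ j + 1" "\<And>i. i \<noteq> j \<Longrightarrow> k $ i = k' $ i" "side_pair c j y y'"
    using up_down_meet[OF assms(1,3) y(1) y'(1)] by metis
  show thesis by (rule that[OF j(1) j(2) j(3) y(2)])
qed

text \<open>Upright cells are translates carrying the same fractal, so the two blow-ups of a common
  point differ by integers in each coordinate and coincide. This excludes contact of pieces at a
  mere vertex.\<close>

lemma pieces_up_disjoint:
  assumes "k \<in> indices (int m - 1)" "up_tri m k \<in> ups S c" "l \<in> indices (int m - 1)" "up_tri m l \<in> ups S c"
    and "x \<in> piece c (up_tri m k)" "x \<in> piece c (up_tri m l)"
  shows "k = l"
proof -
  obtain y where y: "y \<in> fractal c" "\<And>i. m * bary x $ i = k $ i + bary y $ i"
    using piece_up assms by blast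
  obtain z where z: "z \<in> fractal c" "\<And>i. m * bary x $ i = l $ i + bary z $ i"
    using piece_up assms by blast
  have "bary y $ i - bary z $ i = of_int (l $ i - k $ i)" for i using y(2)[of i] z(2)[of i] by simp
  then have "y = z" by (rule eq_if_bary_diff_int[OF y(1) z(1)])
  then have "real_of_int (k $ i) = real_of_int (l $ i)" for i using y(2)[of i] z(2)[of i] by simp
  then show "k = l" by (simp add: vec_eq_iff)
qed

lemma pieces_down_disjoint:
  assumes "k \<in> indices (int m - 2)" "down_tri m k \<in> downs S c" "l \<in> indices (int m - 2)" "down_tri m l \<in> downs S c"
    and "x \<in> piece c (down_tri m k)" "x \<in> piece c (down_tri m l)"
  shows "k = l"
proof -
  obtain y where y: "y \<in> fractal (\<not> c)" "\<And>i. m * bary x $ i = k $ i + 1 - bary y $ i"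
    using piece_down assms by blast
  obtain z where z: "z \<in> fractal (\<not> c)" "\<And>i. m * bary x $ i = l $ i + 1 - bary z $ i"
    using piece_down assms by blast
  have "bary y $ i - bary z $ i = of_int (k $ i - l $ i)" for i using y(2)[of i] z(2)[of i] by simp
  then have "y = z" by (rule eq_if_bary_diff_int[OF y(1) z(1)])
  then have "real_of_int (k $ i) = real_of_int (l $ i)" for i using y(2)[of i] z(2)[of i] by simp
  then show "k = l" by (simp add: vec_eq_iff)
qed

lemma pieces_meet_adjacent:
  assumes "U \<in> cells c" "V \<in> cells c" "U \<noteq> V" "x \<in> piece c U" "x \<in> piece c V"
  shows "adjacent m U V"
proof -
  have *: "neighbours m j (up_tri m k) (down_tri m k')"
    if "k \<in> indices (int m - 1)" "k' \<in> indices (int m - 2)" "k $ j = k' $ j + 1" "\<And>i. i \<noteq> j \<Longrightarrow> k $ i = k' $ i"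
    for j k k'
    using that unfolding neighbours_def by blast
  from assms(1) show ?thesis
  proof (cases rule: cell_cases)
    case outer: (up k)
    from assms(2) show ?thesis
    proof (cases rule: cell_cases)
      case (up l)
      then show ?thesis using pieces_up_disjoint[of k c l x] outer assms(3-5) by auto
    next
      case (down l)
      then show ?thesis
        using piece_up_down_meet[of k c l x] outer assms(4,5) * unfolding adjacent_def by metis
    qed
  next
    case outer: (down k)
    from assms(2) show ?thesis
    proof (cases rule: cell_cases)
      case (up l)
      then show ?thesis
        using piece_up_down_meet[of l c k x] outer assms(4,5) * unfolding adjacent_def by metis
    next
      case (down l)
      then show ?thesis using pieces_down_disjoint[of k c l x] outer assms(3-5) by auto
    qed
  qed
qed

lemma pieces_meet_once:
  assumes "U \<in> cells c" "V \<in> cells c" "U \<noteq> V" "x \<in> piece c U \<inter> piece c V" "z \<in> piece c U \<inter> piece c V"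
  shows "x = z"
proof -
  have *: "x = z"
    if k: "k \<in> indices (int m - 1)" "up_tri m k \<in> ups S c" "k' \<in> indices (int m - 2)" "down_tri m k' \<in> downs S c"
      and x: "x \<in> piece c (up_tri m k)" "x \<in> piece c (down_tri m k')"
      and z: "z \<in> piece c (up_tri m k)" "z \<in> piece c (down_tri m k')" for k k'
  proof -
    obtain j y y' where y: "k $ j = k' $ j + 1" "side_pair c j y y'" "x = tri_map (up_tri m k) y"
      using piece_up_down_meet[OF k x] by metis
    obtain i w w' where w: "\<And>j. j \<noteq> i \<Longrightarrow> k $ j = k' $ j" "side_pair c i w w'" "z = tri_map (up_tri m k) w"
      using piece_up_down_meet[OF k z] by metis
    \<comment> \<open>The indices determine the shared side: \<open>j\<close> is the only place
      where \<open>k\<close> and \<open>k'\<close> differ.\<close>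
    have "i = j" using y(1) w(1)[of j] by auto
    then show "x = z" using side_pair_unique y w by blast
  qed
  from assms(1) show ?thesis
  proof (cases rule: cell_cases)
    case outer: (up k)
    from assms(2) show ?thesis
    proof (cases rule: cell_cases)
      case (up l)
      then show ?thesis using pieces_up_disjoint[of k c l x] outer assms(3-5) by auto
    next
      case (down l)
      then show ?thesis using *[of k l] outer assms(4,5) by auto
    qed
  next
    case outer: (down k)
    from assms(2) show ?thesis
    proof (cases rule: cell_cases)
      case (up l)
      then show ?thesis using *[of l k] outer assms(4,5) by auto
    next
      case (down l)
      then show ?thesis using pieces_down_disjoint[of k c l x] outer assms(3-5) by auto
    qed
  qed
qed

text \<open>The mirror condition of a side pair on side \<open>j\<close> is exactly the condition
  that the cell maps of two \<open>j\<close>-neighbours send its two points to the same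
  place.\<close>

lemma neighbours_meet:
  assumes "U \<in> cells c" "V \<in> cells c" "neighbours m j U V"
  shows "piece c U \<inter> piece c V \<noteq> {}"
proof -
  obtain k k' where k: "k \<in> indices (int m - 1)" "k' \<in> indices (int m - 2)" "U = up_tri m k" "V = down_tri m k'"
    and kj: "k $ j = k' $ j + 1" "\<And>i. i \<noteq> j \<Longrightarrow> k $ i = k' $ i"
    using assms(3) unfolding neighbours_def by metis
  have "U \<in> upright m" "V \<notin> upright m"
    using k disjoint by (auto simp: upright_def inverted_def)
  obtain x x' where xx: "side_pair c j x x'" using side_pair_exists by blast
  then have x: "x \<in> fractal c" "x' \<in> fractal (\<not> c)" "x \<in> full base" "x' \<in> full base"
    using fractal_subset_base by (auto simp: side_pair_def)
  have "k $ i + bary x $ i = k' $ i + 1 - bary x' $ i" for i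
    using xx kj by (cases "i = j") (auto simp: side_pair_def algebra_simps)
  then have "bary (tri_map U x) = bary (tri_map V x')"
    unfolding k(3,4) vec_eq_iff[of "bary _"] using x(3,4) k(1,2) m_pos
    by (simp add: bary_tri_map_up bary_tri_map_down)
  then have "tri_map U x = tri_map V x'" by (simp add: bary_inject)
  moreover have "tri_map U x \<in> piece c U" using x \<open>U \<in> upright m\<close> by (simp add: piece_def)
  moreover have "tri_map V x' \<in> piece c V" using x \<open>V \<notin> upright m\<close> by (simp add: piece_def)
  ultimately show ?thesis by auto
qed

lemma adjacent_meet:
  "U \<in> cells c \<Longrightarrow> V \<in> cells c \<Longrightarrow> adjacent m U V \<Longrightarrow> piece c U \<inter> piece c V \<noteq> {}"
  using neighbours_meet unfolding adjacent_def by (metis Int_commute)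

section \<open>The fractals are dendrites\<close>

lemma tree_cells: "tree (cells c) (adjacent m)"
proof -
  have "tree_property m S" using labyrinth by (simp add: labyrinth_patterns_system_def)
  then show ?thesis by (cases c) (simp_all add: tree_property_def cells_def ups_def downs_def)
qed

lemma fractal_nonempty: "fractal c \<noteq> {}"
  using side_pair_exists[of c] by (auto simp: side_pair_def)

lemma piece_subset: "piece c U \<subseteq> tri_map U ` approx n (c = (U \<in> upright m))"
  unfolding piece_def by (intro image_mono fractal_subset_approx)

text \<open>Neighbouring images meet at every stage since they contain the pieces of the fractal,
  which already meet.\<close>

lemma connected_approx: "connected (approx n c)"
proof (induction n arbitrary: c)
  case 0
  then show ?case by (simp add: approx_0 convex_connected)
next
  case (Suc n)
  show ?case unfolding approx_Suc
  proof (rule connected_Union_connected_graph[where E = "adjacent m"])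
    show "connected_graph (cells c) (adjacent m)" using tree_cells by (simp add: tree_def)
    fix U assume U: "U \<in> cells c"
    show "tri_map U ` approx n (c = (U \<in> upright m)) \<noteq> {}"
      using fractal_nonempty fractal_subset_approx by blast
    show "connected (tri_map U ` approx n (c = (U \<in> upright m)))"
      by (intro connected_continuous_image Suc.IH
          continuous_on_subset[OF continuous_on_tri_map approx_subset_base])
    fix V assume "V \<in> cells c" "adjacent m U V"
    then have "piece c U \<inter> piece c V \<noteq> {}" using U adjacent_meet by blast
    moreover have "piece c U \<inter> piece c V \<subseteq>
        tri_map U ` approx n (c = (U \<in> upright m)) \<inter> tri_map V ` approx n (c = (V \<in> upright m))"
      by (intro Int_mono piece_subset)
    ultimately show "tri_map U ` approx n (c = (U \<in> upright m)) \<inter>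
        tri_map V ` approx n (c = (V \<in> upright m)) \<noteq> {}"
      by (metis subset_empty)
  qed
qed

lemma connected_fractal: "connected (fractal c)"
  unfolding fractal_def
  by (rule connected_nest) (use compact_approx connected_approx approx_antimono in auto)

section \<open>Small covers and local connectedness\<close>

lemma dist_base_le: "x \<in> full base \<Longrightarrow> y \<in> full base \<Longrightarrow> dist x y \<le> diameter (full base)"
  by (intro diameter_bounded_bound compact_imp_bounded compact_convex_hull finite_imp_compact) simp_all

lemma small_covers:
  "\<exists>\<F>. finite \<F> \<and> fractal c = \<Union>\<F> \<and>
    (\<forall>C\<in>\<F>. compact C \<and> connected C \<and> (\<forall>x\<in>C. \<forall>y\<in>C. dist x y \<le> diameter (full base) * (1 / m) ^ n))"
proof (induction n arbitrary: c)
  case 0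
  have "dist x y \<le> diameter (full base)" if "x \<in> fractal c" "y \<in> fractal c" for x y
    using dist_base_le fractal_subset_base that by blast
  then show ?case using compact_fractal connected_fractal by (intro exI[of _ "{fractal c}"]) simp
next
  case (Suc n)
  let ?d = "\<lambda>n. diameter (full base) * (1 / real m) ^ n"
  \<comment> \<open>Covers for both colours are needed at once, since inverted cells carry the other
    fractal.\<close>
  obtain G where fin: "\<And>c. finite (G c)" and cover: "\<And>c. fractal c = \<Union>(G c)"
    and G: "\<And>c C. C \<in> G c \<Longrightarrow> compact C \<and> connected C \<and> (\<forall>x\<in>C. \<forall>y\<in>C. dist x y \<le> ?d n)"
    using Suc.IH by metis
  define d where "d U \<longleftrightarrow> c = (U \<in> upright m)" for U
  define \<F> where "\<F> = (\<Union>U\<in>cells c. (`) (tri_map U) ` G (d U))"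
  have "finite \<F>" unfolding \<F>_def by (intro finite_UN_I finite_cells finite_imageI fin)
  moreover have "fractal c = \<Union>\<F>"
  proof -
    have "fractal c = (\<Union>U\<in>cells c. tri_map U ` \<Union>(G (d U)))"
      using fractal_eq_pieces[of c] by (simp add: piece_def d_def flip: cover)
    also have "\<dots> = \<Union>\<F>" unfolding \<F>_def image_Union by (simp add: Union_eq) blast
    finally show ?thesis .
  qed
  moreover have "compact C \<and> connected C \<and> (\<forall>x\<in>C. \<forall>y\<in>C. dist x y \<le> ?d (Suc n))" if C: "C \<in> \<F>" for C
  proof -
    obtain U B where U: "U \<in> cells c" "B \<in> G (d U)" "C = tri_map U ` B"
      using C unfolding \<F>_def by blast
    have B: "B \<subseteq> full base" using U(2) cover fractal_subset_base by blast
    have cont: "continuous_on B (tri_map U)" using continuous_on_subset[OF continuous_on_tri_map B] .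
    have "compact C" "connected C"
      unfolding U(3) using G[OF U(2)] cont compact_continuous_image connected_continuous_image by blast+
    moreover have "dist (tri_map U x) (tri_map U y) \<le> ?d (Suc n)" if "x \<in> B" "y \<in> B" for x y
    proof -
      have "dist (tri_map U x) (tri_map U y) = dist x y / m"
        using dist_tri_map_cell U(1) B that by blast
      also have "\<dots> \<le> ?d n / m" using G[OF U(2)] that by (intro divide_right_mono) auto
      finally show ?thesis by simp
    qed
    ultimately show ?thesis unfolding U(3) by blast
  qed
  ultimately show ?case by blast
qed

lemma small_diameter: "(\<lambda>n. diameter (full base) * (1 / real m) ^ n) \<longlonglongrightarrow> 0"
proof -
  have "(\<lambda>n. (1 / real m) ^ n) \<longlonglongrightarrow> 0" using m by (intro LIMSEQ_power_zero) simp
  then show ?thesis by (rule tendsto_mult_right_zero)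
qed

lemma locally_connected_fractal: "locally connected (fractal c)"
proof (rule locally_connected_if_finite_small_covers)
  fix \<epsilon> :: real assume "\<epsilon> > 0"
  then obtain n where n: "diameter (full base) * (1 / real m) ^ n < \<epsilon>"
    using order_tendstoD(2)[OF small_diameter] eventually_sequentially by (metis order_refl)
  obtain \<F> where F: "finite \<F>" "fractal c = \<Union>\<F>" "\<And>C. C \<in> \<F> \<Longrightarrow> compact C \<and> connected C \<and>
      (\<forall>x\<in>C. \<forall>y\<in>C. dist x y \<le> diameter (full base) * (1 / m) ^ n)"
    using small_covers[of c n] by metis
  have "closed C \<and> connected C \<and> (\<forall>x\<in>C. \<forall>y\<in>C. dist x y \<le> \<epsilon>)" if "C \<in> \<F>" for C
    using F(3)[OF that] n compact_imp_closed by fastforce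
  then show "\<exists>\<F>. finite \<F> \<and> fractal c = \<Union>\<F> \<and>
      (\<forall>C\<in>\<F>. closed C \<and> connected C \<and> (\<forall>x\<in>C. \<forall>y\<in>C. dist x y \<le> \<epsilon>))"
    using F(1,2) by blast
qed

section \<open>Absence of closed curves\<close>

lemma closed_curve_in_piece:
  assumes "simple_path g" "pathfinish g = pathstart g" "path_image g \<subseteq> fractal c"
  obtains U where "U \<in> cells c" "path_image g \<subseteq> piece c U"
proof -
  have "\<exists>U\<in>cells c. path_image g \<subseteq> piece c U"
  proof (rule closed_curve_in_forest_of_sets[where E = "adjacent m"])
    show "\<nexists>p. graph_cycle (cells c) (adjacent m) p" using tree_cells by (simp add: tree_def)
    show "adjacent m V U" if "adjacent m U V" for U V using that by (auto simp: adjacent_def)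
    show "closed (piece c U)" for U using compact_piece compact_imp_closed by blast
    show "adjacent m U V" if "U \<in> cells c" "V \<in> cells c" "U \<noteq> V" "piece c U \<inter> piece c V \<noteq> {}" for U V
      using pieces_meet_adjacent that by blast
    show "\<exists>p. piece c U \<inter> piece c V \<subseteq> {p}" if "U \<in> cells c" "V \<in> cells c" "U \<noteq> V" for U V
    proof (cases "piece c U \<inter> piece c V = {}")
      case False
      then obtain p where "p \<in> piece c U \<inter> piece c V" by blast
      then have "piece c U \<inter> piece c V \<subseteq> {p}" using pieces_meet_once[OF that] by blast
      then show ?thesis ..
    qed simp
    show "path_image g \<subseteq> \<Union> (piece c ` cells c)" using assms(3) fractal_eq_pieces by simp
  qed (use assms finite_cells in auto)
  then show thesis using that by blast
qed

text \<open>A closed curve in the fractal lies in one piece, so blowing that piece up yields a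
  closed curve in a fractal again, \<open>m\<close> times as large.\<close>

lemma closed_curve_small:
  assumes "simple_path g" "pathfinish g = pathstart g" "path_image g \<subseteq> fractal c"
    and "x \<in> path_image g" "y \<in> path_image g"
  shows "dist x y \<le> diameter (full base) * (1 / m) ^ n"
  using assms
proof (induction n arbitrary: g c x y)
  case 0
  then have "x \<in> full base" "y \<in> full base" using fractal_subset_base by blast+
  then show ?case using dist_base_le by simp
next
  case (Suc n)
  obtain U where U: "U \<in> cells c" "path_image g \<subseteq> piece c U"
    using closed_curve_in_piece[OF Suc.prems(1-3)] by metis
  define d where "d \<longleftrightarrow> c = (U \<in> upright m)"
  have piece: "piece c U = tri_map U ` fractal d" by (simp add: piece_def d_def)
  define f where "f = inv_into (full base) (tri_map U)"
  have inj: "inj_on (tri_map U) (full base)" using inj_on_tri_map_cell U by blast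
  then have f: "f (tri_map U z) = z" if "z \<in> full base" for z using inj that by (simp add: f_def)
  have g_sub: "path_image g \<subseteq> tri_map U ` full base"
    using U(2) fractal_subset_base unfolding piece by blast
  have g_f: "z = tri_map U (f z) \<and> f z \<in> fractal d" if "z \<in> path_image g" for z
  proof -
    obtain w where "w \<in> fractal d" "z = tri_map U w" using U(2) \<open>z \<in> path_image g\<close> unfolding piece by blast
    then show ?thesis using f fractal_subset_base by fastforce
  qed
  \<comment> \<open>A continuous injection on a compact set has a continuous inverse, so blowing up
    preserves simple closed curves.\<close>
  have "continuous_on (tri_map U ` full base) f"
    by (rule continuous_on_inv[OF continuous_on_tri_map])
      (simp_all add: f compact_convex_hull finite_imp_compact)
  then have "continuous_on (path_image g) f" using g_sub continuous_on_subset by blast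
  moreover have "inj_on f (path_image g)" using g_f by (metis inj_onI)
  ultimately have "simple_path (f \<circ> g)" using Suc.prems(1) simple_path_continuous_image by blast
  moreover have "pathfinish (f \<circ> g) = pathstart (f \<circ> g)"
    using Suc.prems(2) by (simp add: pathstart_compose pathfinish_compose)
  moreover have "path_image (f \<circ> g) \<subseteq> fractal d" using g_f by (auto simp: path_image_compose)
  moreover have "f x \<in> path_image (f \<circ> g)" "f y \<in> path_image (f \<circ> g)"
    using Suc.prems by (auto simp: path_image_compose)
  ultimately have "dist (f x) (f y) \<le> diameter (full base) * (1 / m) ^ n" by (rule Suc.IH)
  moreover have "dist x y = dist (f x) (f y) / m"
  proof -
    have "x = tri_map U (f x)" "y = tri_map U (f y)" "f x \<in> full base" "f y \<in> full base"
      using g_f[OF Suc.prems(4)] g_f[OF Suc.prems(5)] fractal_subset_base by blast+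
    then show ?thesis using dist_tri_map_cell[OF U(1), of "f x" "f y"] by simp
  qed
  ultimately show ?case using m_pos by (simp add: divide_right_mono)
qed

text \<open>The bound on distances holds for every \<open>n\<close> and tends to 0, so the curve
  would be a single point.\<close>

lemma no_closed_curve:
  assumes "simple_path g" "pathfinish g = pathstart g" "path_image g \<subseteq> fractal c"
  shows False
proof -
  have "dist x (pathstart g) \<le> 0" if "x \<in> path_image g" for x
    using closed_curve_small[OF assms that pathstart_in_path_image]
    by (intro LIMSEQ_le_const[OF small_diameter]) auto
  then have "path_image g \<subseteq> {pathstart g}" by auto
  then show False using simple_path_not_singleton assms by blast
qed

lemma dendrite_fractal: "dendrite (fractal c)"
  unfolding dendrite_def
  using fractal_nonempty compact_fractal connected_fractal locally_connected_fractal no_closed_curve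
  by blast

end

theorem theorem5p4:
  fixes m :: nat and S :: patterns
  assumes "m \<ge> 2" and "labyrinth_patterns_system m S"
  shows "dendrite (white_fractal S) \<and> dendrite (yellow_fractal S)"
proof -
  interpret labyrinth m S using assms by unfold_locales
  show ?thesis using dendrite_fractal by (simp add: white_fractal_eq yellow_fractal_eq)
qed

end
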